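(* Let $d\ge3$, let $H\le\mathrm{Aut}(T_d)$ be closed, locally transitive and contain an involutive inversion, and let $k\in\mathbb{N}$. Then $H=\mathrm{U}_k^{(l)}(F^{(k)})$ for some labelling $l$ of $T_d$ and some $F^{(k)}\le\mathrm{Aut}(B_{d,k})$ if and only if $H$ satisfies Property $(P_k)$.
   Context: $\Omega$ is a set of cardinality $d\ge3$, and $T_d=(V,E)$ is the $d$-regular tree (Serre's convention: $E$ consists of oriented edges with inversion $e\mapsto\overline e$; $E(x)$ is the set of edges with origin $x$). $\mathrm{Aut}(T_d)$ carries the permutation topology for its action on $V\cup E$. An inversion is an automorphism mapping some edge $e$ to $\overline e$; it is involutive if it has order $2$. $H$ is locally transitive if for every $x\in V$ the stabilizer $H_x$ acts transitively on $E(x)$. Property $(P_k)$, $k\in\mathbb{N}=\{1,2,\dots\}$: for a non-backtracking (finite, half-infinite or infinite) path $C$ in $T_d$, viewed as a subtree, and $j\ge0$, let $C^j$ be the subtree spanned by the vertices at distance at most $j$ from $C$, and let $H_{C^j}$ be its pointwise stabilizer in $H$. Let $p:V\to V(C)$ be the closest point projection. For each $x\in V(C)$, $H_{C^j}$ acts on the subtree spanned by $p^{-1}(x)$; let $H_{C^j}^{(x)}$ be the group of automorphisms of that subtree so induced. There results an injective homomorphism $\varphi_C^{(j)}:H_{C^j}\to\prod_{x\in V(C)}H_{C^j}^{(x)}$. $H$ satisfies Property $(P_k)$ if $\varphi_C^{(k-1)}$ is an isomorphism for every such path $C$. (For closed $H$ it suffices to check this when $C$ is a single edge.) A labelling of $T_d$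 is a map $l:E\to\Omega$ such that for each $x\in V$ the restriction $l_x:E(x)\to\Omega$ is bijective, and $l(e)=l(\overline e)$ for all $e\in E$. $B_{d,k}$ is a fixed labelled tree isomorphic to a ball of radius $k$ in the labelled tree $T_d$; for $x\in V$ let $l_x^k:B(x,k)\to B_{d,k}$ be the unique label-respecting isomorphism. For $g\in\mathrm{Aut}(T_d)$ put $\sigma_k(g,x):=l_{gx}^k\circ g\circ(l_x^k)^{-1}\in\mathrm{Aut}(B_{d,k})$. For $F\le\mathrm{Aut}(B_{d,k})$, $$\mathrm{U}_k^{(l)}(F):=\{g\in\mathrm{Aut}(T_d)\mid\forall x\in V:\ \sigma_k(g,x)\in F\}.$$ *)

theory Defs
  imports
    "Graph_Theory.Pair_Digraph"
    "Graph_Theory.Digraph_Component"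
    "HOL-Algebra.Bij"
    "HOL-Algebra.Product_Groups"
    "HOL-Algebra.Multiplicative_Group"
    "HOL-Analysis.Abstract_Topology"
begin

text \<open>
  A tree has neither loops nor multiple edges, so the set \<open>E\<close> of oriented edges (in the sense
  of Serre) is the symmetric relation \<^term>\<open>parcs T\<close>: the edge \<open>e = (x, y)\<close> has origin \<open>x\<close> and
  terminus \<open>y\<close>, its inverse is \<^term>\<open>prod.swap e\<close>, and \<open>E(x)\<close> is
  \<^term>\<open>out_arcs (with_proj T) x\<close>.
\<close>

text \<open>
  The predicate \<^const>\<open>tree\<close> of the graph library is not usable here: in a symmetric digraph
  an edge followed by its inverse is already a \<open>cycle\<close>. The genuine circuits are the
  cycles of length at least three.
\<close>

definition regular_tree :: "nat \<Rightarrow> 'v pair_pre_digraph \<Rightarrow> bool" where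
  "regular_tree d T \<longleftrightarrow>
     pair_bidirected_digraph T \<and>
     Digraph_Component.connected (with_proj T) \<and>
     \<not> (\<exists>p. pre_digraph.cycle (with_proj T) p \<and> 3 \<le> length p) \<and>
     (\<forall>x\<in>pverts T. out_degree (with_proj T) x = d)"

definition graph_dist :: "'v pair_pre_digraph \<Rightarrow> 'v \<Rightarrow> 'v \<Rightarrow> nat" where
  "graph_dist G x y = (LEAST n. \<exists>p. pre_digraph.awalk (with_proj G) x p y \<and> length p = n)"

definition spanned :: "'v pair_pre_digraph \<Rightarrow> 'v set \<Rightarrow> 'v pair_pre_digraph" where
  "spanned G S = \<lparr>pverts = S, parcs = parcs G \<inter> S \<times> S\<rparr>"

definition ball_at :: "'v pair_pre_digraph \<Rightarrow> 'v \<Rightarrow> nat \<Rightarrow> 'v pair_pre_digraph" where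
  "ball_at G x k = spanned G {y \<in> pverts G. graph_dist G x y \<le> k}"


section \<open>Automorphism groups\<close>

text \<open>
  Automorphisms are given by their action on vertices, as extensional functions; the induced
  action on edges is \<^term>\<open>map_prod g g\<close>.
\<close>

definition graph_auts :: "'v pair_pre_digraph \<Rightarrow> ('v \<Rightarrow> 'v) set" where
  "graph_auts G =
     {g \<in> Bij (pverts G). \<forall>u\<in>pverts G. \<forall>v\<in>pverts G. (g u, g v) \<in> parcs G \<longleftrightarrow> (u, v) \<in> parcs G}"

definition aut_group :: "'v pair_pre_digraph \<Rightarrow> ('v \<Rightarrow> 'v) monoid" where
  "aut_group G = BijGroup (pverts G)\<lparr>carrier := graph_auts G\<rparr>"

lemma group_aut_group: "group (aut_group G)"
proof -
  have "subgroup (graph_auts G) (BijGroup (pverts G))"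
  proof (rule group.subgroupI[OF group_BijGroup])
    show "graph_auts G \<subseteq> carrier (BijGroup (pverts G))"
      by (auto simp: graph_auts_def BijGroup_def)
    have "(\<lambda>x\<in>pverts G. x) \<in> graph_auts G"
      by (simp add: graph_auts_def id_Bij)
    then show "graph_auts G \<noteq> {}" by blast
  next
    fix g assume g: "g \<in> graph_auts G"
    let ?i = "\<lambda>x\<in>pverts G. inv_into (pverts G) g x"
    have bij: "g \<in> Bij (pverts G)" and im: "g ` pverts G = pverts G"
      using g by (auto simp: graph_auts_def Bij_def bij_betw_def)
    have "(?i u, ?i v) \<in> parcs G \<longleftrightarrow> (u, v) \<in> parcs G"
      if uv: "u \<in> pverts G" "v \<in> pverts G" for u v
    proof -
      have "?i u \<in> pverts G" "?i v \<in> pverts G" and eq: "g (?i u) = u" "g (?i v) = v"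
        using uv im by (auto simp: inv_into_into f_inv_into_f)
      then have "(g (?i u), g (?i v)) \<in> parcs G \<longleftrightarrow> (?i u, ?i v) \<in> parcs G"
        using g unfolding graph_auts_def by blast
      then show ?thesis unfolding eq by (rule sym)
    qed
    then show "inv\<^bsub>BijGroup (pverts G)\<^esub> g \<in> graph_auts G"
      using bij by (simp add: inv_BijGroup graph_auts_def restrict_inv_into_Bij)
  next
    fix g h assume gh: "g \<in> graph_auts G" "h \<in> graph_auts G"
    then have "g \<in> Bij (pverts G)" "h \<in> Bij (pverts G)" "h ` pverts G \<subseteq> pverts G"
      by (auto simp: graph_auts_def Bij_def bij_betw_def)
    with gh show "g \<otimes>\<^bsub>BijGroup (pverts G)\<^esub> h \<in> graph_auts G"
      by (auto simp: BijGroup_def graph_auts_def compose_Bij compose_eq image_subset_iff)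
  qed
  then show ?thesis
    unfolding aut_group_def by (rule subgroup.subgroup_is_group[OF _ group_BijGroup])
qed

definition permutation_topology :: "'v pair_pre_digraph \<Rightarrow> ('v \<Rightarrow> 'v) topology" where
  "permutation_topology T = topology_generated_by
     ({{g \<in> graph_auts T. g x = y} | x y. x \<in> pverts T \<and> y \<in> pverts T} \<union>
      {{g \<in> graph_auts T. map_prod g g e = f} | e f. e \<in> parcs T \<and> f \<in> parcs T})"

definition involutive_inversion :: "'v pair_pre_digraph \<Rightarrow> ('v \<Rightarrow> 'v) \<Rightarrow> bool" where
  "involutive_inversion T g \<longleftrightarrow>
     g \<in> graph_auts T \<and> (\<exists>e\<in>parcs T. map_prod g g e = prod.swap e) \<and> group.ord (aut_group T) g = 2"

definition locally_transitive :: "'v pair_pre_digraph \<Rightarrow> ('v \<Rightarrow> 'v) set \<Rightarrow> bool" where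
  "locally_transitive T H \<longleftrightarrow>
     (\<forall>x\<in>pverts T. \<forall>e\<in>out_arcs (with_proj T) x. \<forall>f\<in>out_arcs (with_proj T) x.
        \<exists>h\<in>H. h x = x \<and> map_prod h h e = f)"


section \<open>The independence property\<close>

text \<open>
  A path is a sequence of vertices indexed by \<open>{0..n}\<close> (finite), \<open>{0..}\<close> (half-infinite) or
  all of \<open>\<int>\<close> (infinite). Only its vertex set \<open>C\<close> matters below.
\<close>

definition path_vertices :: "'v pair_pre_digraph \<Rightarrow> 'v set \<Rightarrow> bool" where
  "path_vertices T C \<longleftrightarrow>
     (\<exists>(I :: int set) c.
        ((\<exists>n\<ge>0. I = {0..n}) \<or> I = {0..} \<or> I = UNIV) \<and>
        C = c ` I \<and> C \<subseteq> pverts T \<and>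
        (\<forall>i. i \<in> I \<and> i + 1 \<in> I \<longrightarrow> (c i, c (i + 1)) \<in> parcs T) \<and>
        (\<forall>i. i \<in> I \<and> i + 2 \<in> I \<longrightarrow> c i \<noteq> c (i + 2)))"

definition thicken :: "'v pair_pre_digraph \<Rightarrow> 'v set \<Rightarrow> nat \<Rightarrow> 'v set" where
  "thicken T C j = {y \<in> pverts T. \<exists>x\<in>C. graph_dist T x y \<le> j}"

definition fixator :: "('v \<Rightarrow> 'v) set \<Rightarrow> 'v set \<Rightarrow> ('v \<Rightarrow> 'v) set" where
  "fixator H S = {h \<in> H. \<forall>y\<in>S. h y = y}"

definition closest_point :: "'v pair_pre_digraph \<Rightarrow> 'v set \<Rightarrow> 'v \<Rightarrow> 'v" where
  "closest_point T C y = (THE x. x \<in> C \<and> (\<forall>z\<in>C. graph_dist T y x \<le> graph_dist T y z))"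

definition fibre :: "'v pair_pre_digraph \<Rightarrow> 'v set \<Rightarrow> 'v \<Rightarrow> 'v set" where
  "fibre T C x = {y \<in> pverts T. closest_point T C y = x}"

definition fixator_group ::
    "'v pair_pre_digraph \<Rightarrow> ('v \<Rightarrow> 'v) set \<Rightarrow> 'v set \<Rightarrow> nat \<Rightarrow> ('v \<Rightarrow> 'v) monoid" where
  "fixator_group T H C j = aut_group T\<lparr>carrier := fixator H (thicken T C j)\<rparr>"

definition induced_group ::
    "'v pair_pre_digraph \<Rightarrow> ('v \<Rightarrow> 'v) set \<Rightarrow> 'v set \<Rightarrow> nat \<Rightarrow> 'v \<Rightarrow> ('v \<Rightarrow> 'v) monoid" where
  "induced_group T H C j x = aut_group (spanned T (fibre T C x))
     \<lparr>carrier := (\<lambda>h. restrict h (fibre T C x)) ` fixator H (thicken T C j)\<rparr>"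

definition restriction_map ::
    "'v pair_pre_digraph \<Rightarrow> 'v set \<Rightarrow> ('v \<Rightarrow> 'v) \<Rightarrow> 'v \<Rightarrow> 'v \<Rightarrow> 'v" where
  "restriction_map T C h = (\<lambda>x\<in>C. restrict h (fibre T C x))"

definition property_P :: "nat \<Rightarrow> 'v pair_pre_digraph \<Rightarrow> ('v \<Rightarrow> 'v) set \<Rightarrow> bool" where
  "property_P k T H \<longleftrightarrow>
     (\<forall>C. path_vertices T C \<longrightarrow>
        restriction_map T C
          \<in> iso (fixator_group T H C (k - 1)) (product_group C (induced_group T H C (k - 1))))"


section \<open>Labellings and universal groups\<close>

definition labelling :: "'w set \<Rightarrow> 'v pair_pre_digraph \<Rightarrow> ('v \<times> 'v \<Rightarrow> 'w) \<Rightarrow> bool" where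
  "labelling \<Omega> T l \<longleftrightarrow>
     (\<forall>x\<in>pverts T. bij_betw l (out_arcs (with_proj T) x) \<Omega>) \<and>
     (\<forall>e\<in>parcs T. l e = l (prod.swap e))"

definition label_iso ::
    "'v pair_pre_digraph \<Rightarrow> ('v \<times> 'v \<Rightarrow> 'w) \<Rightarrow> 'b pair_pre_digraph \<Rightarrow> ('b \<times> 'b \<Rightarrow> 'w) \<Rightarrow> ('v \<Rightarrow> 'b) \<Rightarrow> bool"
  where
  "label_iso G l G' l' \<phi> \<longleftrightarrow>
     \<phi> \<in> extensional (pverts G) \<and> bij_betw \<phi> (pverts G) (pverts G') \<and>
     (\<forall>u\<in>pverts G. \<forall>v\<in>pverts G. (\<phi> u, \<phi> v) \<in> parcs G' \<longleftrightarrow> (u, v) \<in> parcs G) \<and>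
     (\<forall>e\<in>parcs G. l' (map_prod \<phi> \<phi> e) = l e)"

text \<open>
  The model \<open>B\<^sub>d\<^sub>,\<^sub>k\<close>, with edge labels \<open>lB\<close>. The labelling of \<open>T\<close> is existentially quantified:
  all labelled balls of radius \<open>k\<close> are isomorphic, whatever the labelling and the centre.
\<close>

definition labelled_ball_model ::
    "'w set \<Rightarrow> 'v pair_pre_digraph \<Rightarrow> nat \<Rightarrow> 'b pair_pre_digraph \<Rightarrow> ('b \<times> 'b \<Rightarrow> 'w) \<Rightarrow> bool" where
  "labelled_ball_model \<Omega> T k B lB \<longleftrightarrow>
     pair_wf_digraph B \<and>
     (\<exists>l x \<phi>. labelling \<Omega> T l \<and> x \<in> pverts T \<and> label_iso (ball_at T x k) l B lB \<phi>)"

definition ball_chart ::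
    "'v pair_pre_digraph \<Rightarrow> nat \<Rightarrow> 'b pair_pre_digraph \<Rightarrow> ('b \<times> 'b \<Rightarrow> 'w) \<Rightarrow> ('v \<times> 'v \<Rightarrow> 'w) \<Rightarrow> 'v \<Rightarrow> 'v \<Rightarrow> 'b"
  where
  "ball_chart T k B lB l x = (THE \<phi>. label_iso (ball_at T x k) l B lB \<phi>)"

definition local_action ::
    "'v pair_pre_digraph \<Rightarrow> nat \<Rightarrow> 'b pair_pre_digraph \<Rightarrow> ('b \<times> 'b \<Rightarrow> 'w) \<Rightarrow> ('v \<times> 'v \<Rightarrow> 'w) \<Rightarrow>
     ('v \<Rightarrow> 'v) \<Rightarrow> 'v \<Rightarrow> 'b \<Rightarrow> 'b"
  where
  "local_action T k B lB l g x =
     (\<lambda>b\<in>pverts B. ball_chart T k B lB l (g x)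
        (g (inv_into (pverts (ball_at T x k)) (ball_chart T k B lB l x) b)))"

definition universal_group ::
    "'v pair_pre_digraph \<Rightarrow> nat \<Rightarrow> 'b pair_pre_digraph \<Rightarrow> ('b \<times> 'b \<Rightarrow> 'w) \<Rightarrow> ('v \<times> 'v \<Rightarrow> 'w) \<Rightarrow>
     ('b \<Rightarrow> 'b) set \<Rightarrow> ('v \<Rightarrow> 'v) set"
  where
  "universal_group T k B lB l F =
     {g \<in> graph_auts T. \<forall>x\<in>pverts T. local_action T k B lB l g x \<in> F}"

end

theory Submission
  imports Defs
begin

text \<open>
Both conditions on \<open>H\<close> say that membership in \<open>H\<close> can be tested on balls of radius \<open>k\<close>. Call \<open>H\<close>
\<open>k\<close>-closed if it contains every automorphism that agrees, on each ball of radius \<open>k\<close>, with some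
element of \<open>H\<close>. For the groups \<open>H\<close> in question, the theorem splits into the two equivalences

  universal group \<open>\<longleftrightarrow>\<close> \<open>k\<close>-closed \<open>\<longleftrightarrow>\<close> Property \<open>(P\<^sub>k)\<close>.

A universal group is \<open>k\<close>-closed because its defining condition at \<open>x\<close> only involves the restriction
of the automorphism to the ball around \<open>x\<close> (\<open>universal_group_k_closed\<close>).

If \<open>H\<close> is \<open>k\<close>-closed and \<open>C\<close> is a path, then one element of the pointwise stabilizer of \<open>C\<^sup>k\<^sup>-\<^sup>1\<close> may be
chosen for each fibre of the projection to \<open>C\<close>, and the choices glue: a ball of radius \<open>k\<close> centred in
one fibre leaves that fibre only inside \<open>C\<^sup>k\<^sup>-\<^sup>1\<close>, where all the chosen elements are trivial
(\<open>k_closed_imp_property_P\<close>).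

Conversely, let \<open>H\<close> be closed with \<open>(P\<^sub>k)\<close> and let \<open>g\<close> agree with \<open>H\<close> on balls of radius \<open>k\<close>. One
finds elements of \<open>H\<close> that agree with \<open>g\<close> on larger and larger finite subtrees by adding one leaf at a
time: after a correction, \<open>g\<close> is trivial near the old subtree, and the independence property for the
edge leading to the new leaf turns a local approximation at the leaf into an element of \<open>H\<close>
supported behind that edge (\<open>locally_in_approximation\<close>). Closedness gives \<open>g \<in> H\<close>.

It remains to write a \<open>k\<close>-closed group as a universal group. The labelling comes from the inversion:
conjugating it by elements of \<open>H\<close> that fix one of its two vertices \<open>x\<close> yields an involution in \<open>H\<close>
for every edge at \<open>x\<close>. These involutions generate a subgroup of \<open>H\<close> that acts simply transitively
on the vertices, so the tree is its Cayley graph, and the Cayley graph labelling is preserved by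
a vertex-transitive subgroup of \<open>H\<close> (\<open>invariant_labelling_exists\<close>). The local actions of
elements of \<open>H\<close> then form a group \<open>F\<close>, since label-preserving elements have trivial local action and
may be used to move any two base points together. An automorphism whose local action at \<open>y\<close> lies in \<open>F\<close>
agrees near \<open>y\<close> with an element of \<open>H\<close>, again up to label-preserving factors
(\<open>universal_group_if_k_closed\<close>).

The geometry rests on one property of trees, \<open>parent_unique\<close>: seen from a vertex \<open>x\<close>, a vertex has
at most one neighbour that is not further away from \<open>x\<close> than itself.
\<close>

section \<open>The path metric of a regular tree\<close>

locale regular_tree_graph =
  fixes d :: nat and T :: "'v pair_pre_digraph"
  assumes regular_tree: "regular_tree d T"
begin

abbreviation V where "V \<equiv> pverts T"
abbreviation E where "E \<equiv> parcs T"
abbreviation dist where "dist \<equiv> graph_dist T"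

lemma pair_bidirected: "pair_bidirected_digraph T"
  using regular_tree by (simp add: regular_tree_def)

lemma edge_verts: assumes "(u, v) \<in> E" shows "u \<in> V" "v \<in> V"
proof -
  interpret pair_bidirected_digraph T by (rule pair_bidirected)
  show "u \<in> V" "v \<in> V" using assms by (auto dest: in_arcsD1 in_arcsD2)
qed

lemma edge_sym: "(u, v) \<in> E \<Longrightarrow> (v, u) \<in> E"
proof -
  interpret pair_bidirected_digraph T by (rule pair_bidirected)
  show "(u, v) \<in> E \<Longrightarrow> (v, u) \<in> E" by (rule arcs_symmetric)
qed

lemma edge_irrefl: "(u, v) \<in> E \<Longrightarrow> u \<noteq> v"
proof -
  interpret pair_bidirected_digraph T by (rule pair_bidirected)
  show "(u, v) \<in> E \<Longrightarrow> u \<noteq> v" using pair_no_loops by fastforce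
qed

lemma strongly_connected_tree: "strongly_connected (with_proj T)"
proof -
  interpret pair_bidirected_digraph T by (rule pair_bidirected)
  show ?thesis
    using regular_tree pair_sym_arcs symmetric_connected_imp_strongly_connected
    by (simp add: regular_tree_def)
qed

lemma verts_nonempty: "V \<noteq> {}"
  using strongly_connected_tree by (auto simp: strongly_connected_def)

lemma connected_rtrancl: "x \<in> V \<Longrightarrow> y \<in> V \<Longrightarrow> (x, y) \<in> E\<^sup>*"
  using strongly_connected_tree
  by (metis reachable_rtranclI strongly_connectedE with_proj_simps(1,3))

text \<open>
Powers of the edge relation carry the distance; they are easier to reverse and to concatenate than
lists of arcs.
\<close>

lemma awalk_iff_relpow:
  assumes "x \<in> V"
  shows "(\<exists>p. pre_digraph.awalk (with_proj T) x p y \<and> length p = n) \<longleftrightarrow> (x, y) \<in> E ^^ n"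
  using assms
proof (induction n arbitrary: x)
  case 0
  then show ?case by (auto simp: pre_digraph.awalk_def pre_digraph.cas.simps)
next
  case (Suc n)
  have "(\<exists>p. pre_digraph.awalk (with_proj T) x p y \<and> length p = Suc n) \<longleftrightarrow>
      (\<exists>z. (x, z) \<in> E \<and> (\<exists>p. pre_digraph.awalk (with_proj T) z p y \<and> length p = n))"
    (is "?L \<longleftrightarrow> ?R")
  proof
    assume ?L
    then obtain p where p: "pre_digraph.awalk (with_proj T) x p y" "length p = Suc n" by blast
    then obtain z p' where p': "p = (x, z) # p'" "(x, z) \<in> E" "set p' \<subseteq> E" "pcas z p' y"
      by (cases p) (auto simp: pre_digraph.awalk_def cas_with_proj_eq)
    then have "pre_digraph.awalk (with_proj T) z p' y \<and> length p' = n"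
      using p(2) edge_verts by (simp add: pre_digraph.awalk_def cas_with_proj_eq)
    then show ?R using p'(2) by blast
  next
    assume ?R
    then obtain z p where "(x, z) \<in> E" "pre_digraph.awalk (with_proj T) z p y" "length p = n" by blast
    then have "pre_digraph.awalk (with_proj T) x ((x, z) # p) y \<and> length ((x, z) # p) = Suc n"
      using Suc.prems by (auto simp: pre_digraph.awalk_def cas_with_proj_eq)
    then show ?L by blast
  qed
  also have "\<dots> \<longleftrightarrow> (\<exists>z. (x, z) \<in> E \<and> (z, y) \<in> E ^^ n)"
    using Suc.IH edge_verts by blast
  also have "\<dots> \<longleftrightarrow> (x, y) \<in> E ^^ Suc n"
    by (metis relpow_Suc_D2 relpow_Suc_I2)
  finally show ?case .
qed

lemma dist_Least: "x \<in> V \<Longrightarrow> dist x y = (LEAST n. (x, y) \<in> E ^^ n)"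
  by (simp add: graph_dist_def awalk_iff_relpow)

lemma dist_relpow: "x \<in> V \<Longrightarrow> y \<in> V \<Longrightarrow> (x, y) \<in> E ^^ dist x y"
  using rtrancl_imp_relpow[OF connected_rtrancl] by (auto simp: dist_Least intro: LeastI_ex)

lemma dist_le: "x \<in> V \<Longrightarrow> (x, y) \<in> E ^^ n \<Longrightarrow> dist x y \<le> n"
  by (simp add: dist_Least Least_le)

lemma dist_eq_0_iff: "x \<in> V \<Longrightarrow> y \<in> V \<Longrightarrow> dist x y = 0 \<longleftrightarrow> x = y"
  using dist_relpow[of x y] dist_le[of x y 0] by auto

lemma dist_self [simp]: "x \<in> V \<Longrightarrow> dist x x = 0"
  by (simp add: dist_eq_0_iff)

lemma relpow_sym: "(x, y) \<in> E ^^ n \<Longrightarrow> (y, x) \<in> E ^^ n"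
  by (induction n arbitrary: y) (auto elim!: relpow_Suc_E intro: relpow_Suc_I2 edge_sym simp del: relpow.simps(2))

lemma dist_sym: "x \<in> V \<Longrightarrow> y \<in> V \<Longrightarrow> dist x y = dist y x"
  by (meson dist_le dist_relpow le_antisym relpow_sym)

lemma dist_triangle: "x \<in> V \<Longrightarrow> y \<in> V \<Longrightarrow> z \<in> V \<Longrightarrow> dist x z \<le> dist x y + dist y z"
  by (meson dist_le dist_relpow relpow_trans)

lemma dist_edge: "(u, v) \<in> E \<Longrightarrow> dist u v = 1"
  using dist_le[of u v 1] dist_eq_0_iff[of u v] edge_verts[of u v] edge_irrefl[of u v] by force

lemma dist_step: "(u, v) \<in> E \<Longrightarrow> x \<in> V \<Longrightarrow> dist x v \<le> Suc (dist x u)"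
  using dist_triangle[of x u v] by (simp add: dist_edge edge_verts)

lemma parent_exists:
  assumes "x \<in> V" "y \<in> V" "x \<noteq> y"
  obtains z where "(z, y) \<in> E" "dist x y = Suc (dist x z)"
proof -
  obtain n where n: "dist x y = Suc n" using assms dist_eq_0_iff[of x y] by (cases "dist x y") auto
  then obtain z where z: "(x, z) \<in> E ^^ n" "(z, y) \<in> E"
    using dist_relpow[OF assms(1,2)] by (auto elim: relpow_Suc_E)
  have "dist x z \<le> n" using dist_le[OF assms(1) z(1)] .
  moreover have "dist x y \<le> Suc (dist x z)" using dist_step z assms by blast
  ultimately have "dist x y = Suc (dist x z)" using n by simp
  with z(2) show thesis by (rule that)
qed

lemma geodesic:
  assumes "x \<in> V" "y \<in> V"
  obtains f where "f 0 = x" "f (dist x y) = y" "\<And>i. i < dist x y \<Longrightarrow> (f i, f (Suc i)) \<in> E"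
    "\<And>i. i \<le> dist x y \<Longrightarrow> dist x (f i) = i"
proof -
  obtain f where f: "f 0 = x" "f (dist x y) = y" "\<And>i. i < dist x y \<Longrightarrow> (f i, f (Suc i)) \<in> E"
    using dist_relpow[OF assms] by (auto simp: relpow_fun_conv)
  have V: "f i \<in> V" if "i \<le> dist x y" for i
    using that f(1) f(3)[of "i - 1"] edge_verts[of "f (i - 1)" "f i"] assms by (cases i) auto
  have up: "dist x (f i) \<le> i" if "i \<le> dist x y" for i
    using that
  proof (induction i)
    case (Suc i)
    then show ?case using dist_step[OF f(3)[of i] assms(1)] by simp
  qed (use f assms in simp)
  have down: "dist x y \<le> dist x (f (dist x y - j)) + j" if "j \<le> dist x y" for j
    using that
  proof (induction j)
    case (Suc j)
    then have "dist x (f (dist x y - j)) \<le> Suc (dist x (f (dist x y - Suc j)))"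
      using f(3)[of "dist x y - Suc j"] dist_step[OF _ assms(1)] by (simp add: Suc_diff_Suc)
    then show ?case using Suc by simp
  qed (use f in simp)
  have "dist x (f i) = i" if "i \<le> dist x y" for i
    using up[OF that] down[of "dist x y - i"] that by simp
  with f that show thesis by blast
qed

lemma pcas_map_sequence:
  "i \<le> j \<Longrightarrow> pcas (c i) (map (\<lambda>t. (c t, c (Suc t))) [i..<j]) (c j)"
  by (induction "j - i" arbitrary: i) (auto simp: upt_conv_Cons)

lemma pawalk_verts_map_sequence:
  "i \<le> j \<Longrightarrow> pawalk_verts (c i) (map (\<lambda>t. (c t, c (Suc t))) [i..<j]) = map c [i..<Suc j]"
  by (induction "j - i" arbitrary: i) (auto simp: upt_conv_Cons)

text \<open>
A closed subwalk of minimal positive length visits distinct vertices. It is not a loop, and it does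
not go back and forth along one edge because the walk does not backtrack, so it is a circuit.
\<close>

lemma no_closed_nonbacktracking_walk:
  assumes edges: "\<And>i. i < n \<Longrightarrow> (c i, c (Suc i)) \<in> E"
    and nb: "\<And>i. Suc (Suc i) \<le> n \<Longrightarrow> c i \<noteq> c (Suc (Suc i))"
    and n: "0 < n"
  shows "c 0 \<noteq> c n"
proof
  assume closed: "c 0 = c n"
  define P where "P m \<longleftrightarrow> (\<exists>i. 0 < m \<and> i + m \<le> n \<and> c i = c (i + m))" for m
  have "P n" using closed n by (auto simp: P_def intro!: exI[of _ 0])
  define m where "m = (LEAST m. P m)"
  have Pm: "P m" using \<open>P n\<close> unfolding m_def by (rule LeastI)
  have min: "\<not> P m'" if "m' < m" for m' using that not_less_Least unfolding m_def by blast
  obtain i where i: "0 < m" "i + m \<le> n" "c i = c (i + m)" using Pm by (auto simp: P_def)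
  have "m \<noteq> 1" using i edges[of i] edge_irrefl by fastforce
  moreover have "m \<noteq> 2" using i nb[of i] by force
  ultimately have m3: "3 \<le> m" using i by simp
  let ?p = "map (\<lambda>t. (c t, c (Suc t))) [i..<i+m]"
  have inj: "inj_on c {Suc i..<Suc (i + m)}"
  proof (rule linorder_inj_onI)
    fix s t assume st: "s < t" "s \<in> {Suc i..<Suc (i + m)}" "t \<in> {Suc i..<Suc (i + m)}"
    then obtain r where r: "t = s + r" "0 < r" using less_imp_add_positive by blast
    with st have "r < m" by auto
    from min[OF this] show "c s \<noteq> c t" using st i(2) r by (auto simp: P_def)
  qed auto
  have "distinct (tl (pawalk_verts (c i) ?p))"
    using inj by (simp add: pawalk_verts_map_sequence upt_conv_Cons distinct_map del: upt_Suc)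
  moreover have "pcas (c i) ?p (c i)"
    using pcas_map_sequence[of i "i + m" c] i(3) by simp
  moreover have "set ?p \<subseteq> E" using edges i(2) by auto
  moreover have "c i \<in> V" using edges[of i] edge_verts i by fastforce
  ultimately have "pre_digraph.cycle (with_proj T) ?p"
    using i(1) by (auto simp: pre_digraph.cycle_def pre_digraph.awalk_def cas_with_proj_eq
        awalk_verts_with_proj_eq)
  moreover have "3 \<le> length ?p" using m3 by simp
  ultimately show False using regular_tree unfolding regular_tree_def by blast
qed

text \<open>
Two such neighbours would give a closed walk: a geodesic from \<open>x\<close> to the first, the two edges through
\<open>y\<close>, and a geodesic back from the second. The distance bounds ensure that neither geodesic
ends with a step that comes from \<open>y\<close>, so the walk does not backtrack.
\<close>

lemma parent_unique:
  assumes "x \<in> V" and e: "(y, z\<^sub>1) \<in> E" "(y, z\<^sub>2) \<in> E"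
    and le: "dist x z\<^sub>1 \<le> dist x y" "dist x z\<^sub>2 \<le> dist x y"
  shows "z\<^sub>1 = z\<^sub>2"
proof (rule ccontr)
  assume neq: "z\<^sub>1 \<noteq> z\<^sub>2"
  have V: "y \<in> V" "z\<^sub>1 \<in> V" "z\<^sub>2 \<in> V" using e edge_verts by auto
  obtain p where p: "p 0 = x" "p (dist x z\<^sub>1) = z\<^sub>1" "\<And>i. i < dist x z\<^sub>1 \<Longrightarrow> (p i, p (Suc i)) \<in> E"
    "\<And>i. i \<le> dist x z\<^sub>1 \<Longrightarrow> dist x (p i) = i" using geodesic[OF assms(1) V(2)] by metis
  obtain q where q: "q 0 = x" "q (dist x z\<^sub>2) = z\<^sub>2" "\<And>i. i < dist x z\<^sub>2 \<Longrightarrow> (q i, q (Suc i)) \<in> E"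
    "\<And>i. i \<le> dist x z\<^sub>2 \<Longrightarrow> dist x (q i) = i" using geodesic[OF assms(1) V(3)] by metis
  define n m where "n = dist x z\<^sub>1" and "m = dist x z\<^sub>2"
  note p = p[folded n_def] and q = q[folded m_def] and le = le[folded n_def m_def]
  \<comment> \<open>The closed walk: out along \<open>p\<close>, through \<open>y\<close> at time \<open>n + 1\<close>, and back along \<open>q\<close> reversed.\<close>
  define c where "c i = (if i \<le> n then p i else if i = Suc n then y else q (n + 2 + m - i))" for i
  have "c 0 \<noteq> c (n + m + 2)"
  proof (rule no_closed_nonbacktracking_walk)
    fix i assume i: "i < n + m + 2"
    consider "i < n" | "i = n" | "i = Suc n" | "Suc n < i" by linarith
    then show "(c i, c (Suc i)) \<in> E"
    proof cases
      case 1 then show ?thesis using p(3) by (simp add: c_def)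
    next
      case 2 then show ?thesis using p(2) e(1) by (simp add: c_def edge_sym)
    next
      case 3 then show ?thesis using q(2) e(2) by (simp add: c_def)
    next
      case 4
      have "(q (n + m + 2 - Suc i), q (Suc (n + m + 2 - Suc i))) \<in> E"
        using 4 i by (intro q(3)) auto
      moreover have "Suc (n + m + 2 - Suc i) = n + 2 + m - i" using i by simp
      moreover have "n + m + 2 - Suc i = n + 2 + m - Suc i" by simp
      ultimately show ?thesis using 4 by (simp add: c_def edge_sym)
    qed
  next
    fix i assume i: "Suc (Suc i) \<le> n + m + 2"
    consider "Suc (Suc i) \<le> n" | "Suc i = n" | "i = n" | "i = Suc n" | "Suc n < i" by linarith
    then show "c i \<noteq> c (Suc (Suc i))"
    proof cases
      case 1
      then have "dist x (p i) \<noteq> dist x (p (Suc (Suc i)))" using p(4) by simp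
      with 1 show ?thesis by (auto simp: c_def)
    next
      case 2
      then have "dist x (p i) = i" using p(4) by simp
      then have "p i \<noteq> y" using 2 le by auto
      with 2 show ?thesis by (auto simp: c_def)
    next
      case 3 then show ?thesis using p(2) q(2) neq by (simp add: c_def)
    next
      case 4
      then have "dist x (q (m - 1)) = m - 1" "0 < m" using q(4) i by auto
      then have "q (m - 1) \<noteq> y" using le by auto
      moreover have "n + 2 + m - Suc (Suc i) = m - 1" using 4 by simp
      ultimately show ?thesis using 4 by (auto simp: c_def)
    next
      case 5
      have "n + 2 + m - i \<le> m" "n + 2 + m - Suc (Suc i) \<le> m" using 5 by auto
      then have "dist x (q (n + 2 + m - i)) \<noteq> dist x (q (n + 2 + m - Suc (Suc i)))"
        using q(4) i by simp
      with 5 show ?thesis by (auto simp: c_def)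
    qed
  qed simp
  then show False using p(1) q(1) by (simp add: c_def)
qed

lemma dist_edge_cases:
  assumes "(u, v) \<in> E" "x \<in> V"
  obtains "dist x v = Suc (dist x u)" | "dist x u = Suc (dist x v)"
proof -
  have V: "u \<in> V" "v \<in> V" using assms edge_verts by auto
  have "dist x u \<noteq> dist x v"
  proof
    assume eq: "dist x u = dist x v"
    have "x \<noteq> u"
      using eq V edge_irrefl[OF assms(1)] dist_eq_0_iff[OF V] dist_self[OF V(1)] by force
    with assms(2) V(1) obtain p where p: "(p, u) \<in> E" "dist x u = Suc (dist x p)"
      by (rule parent_exists)
    have "p = v"
      by (rule parent_unique[OF assms(2) edge_sym[OF p(1)] assms(1)]) (use p eq in auto)
    then show False using p eq by simp
  qed
  moreover have "dist x v \<le> Suc (dist x u)" "dist x u \<le> Suc (dist x v)"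
    using dist_step assms edge_sym by blast+
  ultimately show thesis using that by linarith
qed

lemma dist_away_from_parent:
  assumes "x \<in> V" "(y, z) \<in> E" "dist x z \<le> dist x y" "(y, w) \<in> E" "w \<noteq> z"
  shows "dist x w = Suc (dist x y)"
proof (rule dist_edge_cases[OF assms(4,1)])
  assume "dist x y = Suc (dist x w)"
  then have "z = w" by (intro parent_unique[OF assms(1,2,4,3)]) simp
  then show ?thesis using assms(5) by simp
qed

end

context regular_tree_graph
begin

section \<open>Closest points on paths\<close>

definition nonbacktracking :: "int set \<Rightarrow> (int \<Rightarrow> 'v) \<Rightarrow> bool" where
  "nonbacktracking I c \<longleftrightarrow>
     (\<forall>i\<in>I. c i \<in> V) \<and>
     (\<forall>i j t. i \<in> I \<and> j \<in> I \<and> i \<le> t \<and> t \<le> j \<longrightarrow> t \<in> I) \<and>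
     (\<forall>i. i \<in> I \<and> i + 1 \<in> I \<longrightarrow> (c i, c (i + 1)) \<in> E) \<and>
     (\<forall>i. i \<in> I \<and> i + 2 \<in> I \<longrightarrow> c i \<noteq> c (i + 2))"

lemma nonbacktrackingD:
  assumes "nonbacktracking I c"
  shows "i \<in> I \<Longrightarrow> c i \<in> V"
    and "i \<in> I \<Longrightarrow> j \<in> I \<Longrightarrow> i \<le> t \<Longrightarrow> t \<le> j \<Longrightarrow> t \<in> I"
    and "i \<in> I \<Longrightarrow> i + 1 \<in> I \<Longrightarrow> (c i, c (i + 1)) \<in> E"
    and "i \<in> I \<Longrightarrow> i + 2 \<in> I \<Longrightarrow> c i \<noteq> c (i + 2)"
  using assms unfolding nonbacktracking_def by blast+

text \<open>
This makes it enough to study distances in the direction of increasing indices.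
\<close>

lemma nonbacktracking_reverse:
  assumes "nonbacktracking I c"
  shows "nonbacktracking (uminus ` I) (\<lambda>i. c (- i))"
proof -
  have mem: "i \<in> uminus ` I \<longleftrightarrow> - i \<in> I" for i :: int
    by (metis image_eqI imageE minus_minus)
  have "(c (- i), c (- (i + 1))) \<in> E" if "- i \<in> I" "- (i + 1) \<in> I" for i
  proof -
    have "(c (- (i + 1)), c (- (i + 1) + 1)) \<in> E"
      by (rule nonbacktrackingD(3)[OF assms]) (use that in auto)
    then show ?thesis using edge_sym by simp
  qed
  moreover have "c (- i) \<noteq> c (- (i + 2))" if "- i \<in> I" "- (i + 2) \<in> I" for i
  proof -
    have "c (- (i + 2)) \<noteq> c (- (i + 2) + 2)"
      by (rule nonbacktrackingD(4)[OF assms]) (use that in auto)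
    then show ?thesis by simp
  qed
  moreover have "- t \<in> I" if "- i \<in> I" "- j \<in> I" "i \<le> t" "t \<le> j" for i j t
    using nonbacktrackingD(2)[OF assms that(2,1), of "- t"] that by simp
  moreover have "c (- i) \<in> V" if "- i \<in> I" for i
    using that by (rule nonbacktrackingD(1)[OF assms])
  ultimately show ?thesis unfolding nonbacktracking_def Ball_def mem by blast
qed

lemma path_vertices_nonbacktracking:
  assumes "path_vertices T C"
  obtains I c where "nonbacktracking I c" "C = c ` I" "I \<noteq> {}"
proof -
  obtain I :: "int set" and c :: "int \<Rightarrow> 'v"
    where I: "(\<exists>n\<ge>0. I = {0..n}) \<or> I = {0..} \<or> I = UNIV"
    and c: "C = c ` I" "C \<subseteq> V" "\<forall>i. i \<in> I \<and> i + 1 \<in> I \<longrightarrow> (c i, c (i + 1)) \<in> E"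
      "\<forall>i. i \<in> I \<and> i + 2 \<in> I \<longrightarrow> c i \<noteq> c (i + 2)"
    using assms unfolding path_vertices_def by blast
  have "\<forall>i j t. i \<in> I \<and> j \<in> I \<and> i \<le> t \<and> t \<le> j \<longrightarrow> t \<in> I" using I by auto
  moreover have "0 \<in> I" using I by auto
  ultimately show thesis using that[of I c] c unfolding nonbacktracking_def by blast
qed

text \<open>
Once a step leads away from \<open>y\<close>, the vertex just left is the parent as seen from \<open>y\<close>, and a path that
does not return to it must continue to move away.
\<close>

lemma dist_increasing_along_path:
  assumes c: "nonbacktracking I c" and y: "y \<in> V"
    and i: "i \<in> I" "i + 1 \<in> I" "dist y (c (i + 1)) = Suc (dist y (c i))"
    and "i + 1 + int n \<in> I"
  shows "dist y (c (i + 1 + int n)) = Suc (dist y (c (i + int n)))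
    \<and> dist y (c (i + 1 + int n)) = dist y (c i) + 1 + n"
  using assms(6)
proof (induction n)
  case (Suc n)
  define m where "m = i + int n"
  have m: "i + 1 + int (Suc n) = m + 2" "i + int (Suc n) = m + 1" "i + 1 + int n = m + 1"
    by (auto simp: m_def)
  have I: "m + 2 \<in> I" using Suc.prems unfolding m .
  have conv: "t \<in> I" if "i \<le> t" "t \<le> m + 2" for t
    by (rule nonbacktrackingD(2)[OF c i(1) I that])
  have mI: "m \<in> I" "m + 1 \<in> I" by (auto intro!: conv simp: m_def)
  have IH: "dist y (c (m + 1)) = Suc (dist y (c m))" "dist y (c (m + 1)) = dist y (c i) + 1 + n"
    using Suc.IH mI unfolding m m_def[symmetric] by auto
  have e: "(c m, c (m + 1)) \<in> E" "(c (m + 1), c (m + 2)) \<in> E" "c m \<noteq> c (m + 2)"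
    using nonbacktrackingD(3)[OF c, of m] nonbacktrackingD(3)[OF c, of "m + 1"]
      nonbacktrackingD(4)[OF c, of m] mI I by (auto simp: add.assoc)
  have "dist y (c (m + 2)) = Suc (dist y (c (m + 1)))"
    by (rule dist_away_from_parent[OF y edge_sym[OF e(1)] _ e(2)]) (use IH e in auto)
  then show ?case unfolding m using IH by simp
qed (use i in simp)

lemma dist_from_closest_forward:
  assumes c: "nonbacktracking I c" and y: "y \<in> V"
    and i: "i \<in> I" "\<And>j. j \<in> I \<Longrightarrow> dist y (c i) \<le> dist y (c j)"
    and j: "j \<in> I" "i < j"
  shows "dist y (c j) = dist y (c i) + nat (j - i)"
proof -
  have I: "i + 1 \<in> I" using nonbacktrackingD(2)[OF c i(1) j(1)] j(2) by simp
  have e: "(c i, c (i + 1)) \<in> E" using nonbacktrackingD(3)[OF c i(1) I] .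
  have up: "dist y (c (i + 1)) = Suc (dist y (c i))"
    by (rule dist_edge_cases[OF e y]) (use i(2)[OF I] in auto)
  define n where "n = nat (j - i - 1)"
  have jn: "j = i + 1 + int n" using j by (simp add: n_def)
  have "dist y (c j) = dist y (c i) + 1 + n"
    using dist_increasing_along_path[OF c y i(1) I up, of n] j(1) unfolding jn by blast
  then show ?thesis unfolding jn by simp
qed

lemma dist_from_closest:
  assumes c: "nonbacktracking I c" and y: "y \<in> V"
    and i: "i \<in> I" "\<And>j. j \<in> I \<Longrightarrow> dist y (c i) \<le> dist y (c j)"
    and j: "j \<in> I"
  shows "dist y (c j) = dist y (c i) + nat \<bar>j - i\<bar>"
proof -
  consider "i < j" | "i = j" | "j < i" by linarith
  then show ?thesis
  proof cases
    case 1 then show ?thesis using dist_from_closest_forward[OF c y i j] by simp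
  next
    case 3
    have "dist y (c (- (- j))) = dist y (c (- (- i))) + nat (- j - - i)"
      by (rule dist_from_closest_forward[OF nonbacktracking_reverse[OF c] y]) (use i j 3 in auto)
    with 3 show ?thesis by simp
  qed simp
qed

lemma path_subset: "path_vertices T C \<Longrightarrow> C \<subseteq> V"
  by (auto simp: path_vertices_def)

lemma closest_index:
  fixes c :: "int \<Rightarrow> 'v"
  assumes "I \<noteq> {}"
  obtains i where "i \<in> I" "\<And>j. j \<in> I \<Longrightarrow> dist y (c i) \<le> dist y (c j)"
  using ex_has_least_nat[of "\<lambda>i. i \<in> I" _ "\<lambda>i. dist y (c i)"] assms by blast

lemma closest_point_unique:
  assumes C: "path_vertices T C" and y: "y \<in> V"
  shows "\<exists>!x. x \<in> C \<and> (\<forall>z\<in>C. dist y x \<le> dist y z)"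
proof -
  obtain I c where c: "nonbacktracking I c" "C = c ` I" "I \<noteq> {}"
    using C by (rule path_vertices_nonbacktracking)
  obtain i where i: "i \<in> I" "\<And>j. j \<in> I \<Longrightarrow> dist y (c i) \<le> dist y (c j)"
    using c(3) by (rule closest_index[where y = y and c = c]) blast
  show ?thesis
  proof (rule ex1I[of _ "c i"])
    show "c i \<in> C \<and> (\<forall>z\<in>C. dist y (c i) \<le> dist y z)" using i c(2) by auto
  next
    fix x assume x: "x \<in> C \<and> (\<forall>z\<in>C. dist y x \<le> dist y z)"
    then obtain j where j: "j \<in> I" "x = c j" using c(2) by auto
    then have "dist y (c j) \<le> dist y (c i)" using x i(1) c(2) by auto
    then have "i = j" using dist_from_closest[OF c(1) y i j(1)] by simp
    then show "x = c i" using j by simp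
  qed
qed

lemma closest_point:
  assumes "path_vertices T C" "y \<in> V"
  shows "closest_point T C y \<in> C" "z \<in> C \<Longrightarrow> dist y (closest_point T C y) \<le> dist y z"
  using theI'[OF closest_point_unique[OF assms]] unfolding closest_point_def by auto

lemma closest_point_eqI:
  assumes "path_vertices T C" "y \<in> V" "x \<in> C" "\<And>z. z \<in> C \<Longrightarrow> dist y x \<le> dist y z"
  shows "closest_point T C y = x"
  using the1_equality[OF closest_point_unique[OF assms(1,2)]] assms(3,4)
  unfolding closest_point_def by blast

text \<open>
Let \<open>x\<close> and \<open>x'\<close> be the two projections. Along the path, distances from \<open>u\<close> grow from \<open>x\<close> and those
from \<open>v\<close> grow from \<open>x'\<close>; as \<open>u\<close> and \<open>v\<close> are adjacent, this forces \<open>x\<close> and \<open>x'\<close> to be adjacent and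
equally far from \<open>u\<close> and \<open>v\<close> respectively. If that distance were positive, the parent of \<open>u\<close> towards
\<open>x\<close> and the vertex \<open>v\<close> would both lie no further from \<open>x'\<close> than \<open>u\<close>. So different fibres are joined by
edges of the path only.
\<close>

lemma closest_point_crossing:
  assumes C: "path_vertices T C" and e: "(u, v) \<in> E"
    and neq: "closest_point T C u \<noteq> closest_point T C v"
  shows "closest_point T C u = u \<and> closest_point T C v = v"
proof -
  have V: "u \<in> V" "v \<in> V" using e edge_verts by auto
  obtain I c where c: "nonbacktracking I c" "C = c ` I" "I \<noteq> {}"
    using C by (rule path_vertices_nonbacktracking)
  obtain i where i: "i \<in> I" "closest_point T C u = c i"
    using closest_point(1)[OF C V(1)] c(2) by auto
  obtain j where j: "j \<in> I" "closest_point T C v = c j"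
    using closest_point(1)[OF C V(2)] c(2) by auto
  have cV: "c i \<in> V" "c j \<in> V" using i j nonbacktrackingD(1)[OF c(1)] by auto
  have di: "dist u (c j) = dist u (c i) + nat \<bar>j - i\<bar>"
    by (rule dist_from_closest[OF c(1) V(1) i(1) _ j(1)])
      (use closest_point(2)[OF C V(1)] i c(2) in auto)
  have dj: "dist v (c i) = dist v (c j) + nat \<bar>i - j\<bar>"
    by (rule dist_from_closest[OF c(1) V(2) j(1) _ i(1)])
      (use closest_point(2)[OF C V(2)] j c(2) in auto)
  have "i \<noteq> j" using neq i j by auto
  have le: "dist u (c j) \<le> Suc (dist v (c j))" "dist v (c i) \<le> Suc (dist u (c i))"
    using dist_triangle[OF V(1,2) cV(2)] dist_triangle[OF V(2,1) cV(1)] dist_edge[OF e]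
      dist_edge[OF edge_sym[OF e]] by auto
  have one: "\<bar>j - i\<bar> = 1" and ab: "dist u (c i) = dist v (c j)"
    using di dj le \<open>i \<noteq> j\<close> by auto
  have "(c i, c j) \<in> E"
  proof (cases "j = i + 1")
    case True then show ?thesis using nonbacktrackingD(3)[OF c(1), of i] i j by blast
  next
    case False
    then have "i = j + 1" using one by simp
    then show ?thesis using nonbacktrackingD(3)[OF c(1), of j] i j edge_sym by blast
  qed
  have "u = c i"
  proof (rule ccontr)
    assume "u \<noteq> c i"
    then have "c i \<noteq> u" by simp
    with cV(1) V(1) obtain p where p: "(p, u) \<in> E" "dist (c i) u = Suc (dist (c i) p)"
      by (rule parent_exists)
    have pV: "p \<in> V" using p(1) edge_verts by blast
    have 1: "dist (c j) u = Suc (dist (c i) u)" "dist (c j) v = dist (c i) u"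
      "dist (c i) v = Suc (dist (c i) u)"
      using di dj one ab dist_sym[OF V(1) cV(1)] dist_sym[OF V(1) cV(2)] dist_sym[OF V(2) cV(1)]
        dist_sym[OF V(2) cV(2)] by auto
    have 2: "dist (c j) p \<le> Suc (dist (c i) p)"
      using dist_step[OF \<open>(c i, c j) \<in> E\<close> pV] dist_sym[OF pV cV(1)] dist_sym[OF pV cV(2)] by simp
    have "p = v"
      by (rule parent_unique[OF cV(2) edge_sym[OF p(1)] e]) (use p 1 2 in auto)
    then show False using p 1 by simp
  qed
  moreover have "v = c j" using ab \<open>u = c i\<close> dist_eq_0_iff[OF V(2) cV(2)] V(1) by simp
  ultimately show ?thesis using i j by simp
qed

lemma edge_path_vertices:
  assumes "(x, y) \<in> E"
  shows "path_vertices T {x, y}"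
proof -
  have I: "\<exists>n::int\<ge>0. {0, 1} = {0..n}" by (rule exI[of _ 1]) auto
  show ?thesis unfolding path_vertices_def
    by (rule exI[of _ "{0, 1}"], rule exI[of _ "\<lambda>i. if i = 0 then x else y"])
      (use assms edge_verts[OF assms] I in auto)
qed

lemma closest_point_edge:
  assumes "(x, y) \<in> E" "z \<in> V"
  shows "closest_point T {x, y} z = (if dist z x < dist z y then x else y)"
  using assms by (auto intro!: closest_point_eqI edge_path_vertices)

end

section \<open>Automorphisms and gluing along the fibres of a path\<close>

context regular_tree_graph
begin

abbreviation Aut where "Aut \<equiv> graph_auts T"

lemma autD:
  assumes "g \<in> Aut"
  shows "g \<in> extensional V" "bij_betw g V V" "g \<in> Bij V"
    and "u \<in> V \<Longrightarrow> g u \<in> V"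
    and "u \<in> V \<Longrightarrow> v \<in> V \<Longrightarrow> (g u, g v) \<in> E \<longleftrightarrow> (u, v) \<in> E"
    and "u \<in> V \<Longrightarrow> v \<in> V \<Longrightarrow> g u = g v \<longleftrightarrow> u = v"
proof -
  show ext: "g \<in> extensional V" and bij: "bij_betw g V V" and "g \<in> Bij V"
    using assms unfolding graph_auts_def Bij_def by simp_all
  show "u \<in> V \<Longrightarrow> g u \<in> V" using bij_betwE[OF bij] by blast
  show "u \<in> V \<Longrightarrow> v \<in> V \<Longrightarrow> (g u, g v) \<in> E \<longleftrightarrow> (u, v) \<in> E"
    using assms unfolding graph_auts_def by simp
  show "u \<in> V \<Longrightarrow> v \<in> V \<Longrightarrow> g u = g v \<longleftrightarrow> u = v"
    by (rule inj_on_eq_iff[OF bij_betw_imp_inj_on[OF bij]])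
qed

lemma aut_edge: "g \<in> Aut \<Longrightarrow> (u, v) \<in> E \<Longrightarrow> (g u, g v) \<in> E"
  using autD(5) edge_verts by blast

lemma aut_surj: assumes "g \<in> Aut" "y \<in> V" obtains x where "x \<in> V" "g x = y"
  using autD(2)[OF assms(1)] assms(2) by (metis bij_betw_def imageE)

lemma aut_eqI: "g \<in> Aut \<Longrightarrow> h \<in> Aut \<Longrightarrow> (\<And>x. x \<in> V \<Longrightarrow> g x = h x) \<Longrightarrow> g = h"
  by (meson autD(1) extensionalityI)

lemma aut_mult: "g \<in> Aut \<Longrightarrow> h \<in> Aut \<Longrightarrow> g \<otimes>\<^bsub>aut_group T\<^esub> h = compose V g h"
  by (simp add: aut_group_def BijGroup_def autD(3))

lemma aut_one: "\<one>\<^bsub>aut_group T\<^esub> = (\<lambda>x\<in>V. x)"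
  by (simp add: aut_group_def BijGroup_def)

lemma aut_carrier: "carrier (aut_group T) = Aut"
  by (simp add: aut_group_def)

lemma aut_relpow: "g \<in> Aut \<Longrightarrow> (x, y) \<in> E ^^ n \<Longrightarrow> (g x, g y) \<in> E ^^ n"
proof (induction n arbitrary: y)
  case (Suc n)
  from Suc.prems(2) obtain z where "(x, z) \<in> E ^^ n" "(z, y) \<in> E" by (rule relpow_Suc_E)
  then show ?case using Suc.IH[OF Suc.prems(1)] aut_edge[OF Suc.prems(1)] by (meson relpow_Suc_I)
qed simp

lemma aut_dist_le: "g \<in> Aut \<Longrightarrow> x \<in> V \<Longrightarrow> y \<in> V \<Longrightarrow> dist (g x) (g y) \<le> dist x y"
  by (simp add: aut_relpow autD(4) dist_le dist_relpow)

end

locale tree_subgroup = regular_tree_graph +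
  fixes H
  assumes subgroup: "subgroup H (aut_group T)"
begin

lemma H_aut: "h \<in> H \<Longrightarrow> h \<in> Aut"
  using subgroup.subset[OF subgroup] by (auto simp: aut_carrier)

lemma H_one: "(\<lambda>x\<in>V. x) \<in> H"
  using subgroup.one_closed[OF subgroup] by (simp add: aut_one)

lemma H_compose: "g \<in> H \<Longrightarrow> h \<in> H \<Longrightarrow> compose V g h \<in> H"
  using subgroup.m_closed[OF subgroup, of g h] by (simp add: aut_mult H_aut)

lemma H_inverse:
  assumes "h \<in> H"
  obtains h' where "h' \<in> H" "\<And>x. x \<in> V \<Longrightarrow> h' (h x) = x" "\<And>x. x \<in> V \<Longrightarrow> h (h' x) = x"
proof -
  let ?h' = "inv\<^bsub>aut_group T\<^esub> h"
  have h': "?h' \<in> H" using subgroup.m_inv_closed[OF subgroup assms] .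
  have "compose V ?h' h = (\<lambda>x\<in>V. x)" "compose V h ?h' = (\<lambda>x\<in>V. x)"
    using group.l_inv[OF group_aut_group, of h T] group.r_inv[OF group_aut_group, of h T] h' assms
    by (simp_all add: aut_mult H_aut aut_one aut_carrier)
  then have "x \<in> V \<Longrightarrow> ?h' (h x) = x" "x \<in> V \<Longrightarrow> h (?h' x) = x" for x
    by (metis compose_eq restrict_apply')+
  with h' that show thesis by blast
qed

end

context regular_tree_graph
begin

lemma tree_subgroup_Aut: "tree_subgroup d T Aut"
  using group.subgroup_self[OF group_aut_group, of T] regular_tree
  by (simp add: tree_subgroup_def tree_subgroup_axioms_def regular_tree_graph_def aut_carrier)

lemma aut_dist:
  assumes "g \<in> Aut" "x \<in> V" "y \<in> V"
  shows "dist (g x) (g y) = dist x y"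
proof -
  obtain g' where g': "g' \<in> Aut" "\<And>x. x \<in> V \<Longrightarrow> g' (g x) = x"
    using tree_subgroup.H_inverse[OF tree_subgroup_Aut assms(1)] by metis
  have "dist x y \<le> dist (g x) (g y)"
    using aut_dist_le[OF g'(1), of "g x" "g y"] g'(2) assms autD(4) by simp
  with aut_dist_le[OF assms] show ?thesis by simp
qed

definition locally_in :: "nat \<Rightarrow> ('v \<Rightarrow> 'v) set \<Rightarrow> ('v \<Rightarrow> 'v) \<Rightarrow> bool" where
  "locally_in k H g \<longleftrightarrow> (\<forall>x\<in>V. \<exists>h\<in>H. \<forall>y\<in>V. dist x y \<le> k \<longrightarrow> g y = h y)"

definition k_closed :: "nat \<Rightarrow> ('v \<Rightarrow> 'v) set \<Rightarrow> bool" where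
  "k_closed k H \<longleftrightarrow> (\<forall>g\<in>Aut. locally_in k H g \<longrightarrow> g \<in> H)"

text \<open>
A geodesic from \<open>y\<close> to \<open>z\<close> has to pass from one fibre to another, which is only possible along an edge
of \<open>C\<close>; so it enters the fibre of \<open>z\<close> at a vertex of \<open>C\<close> different from \<open>y\<close>.
\<close>

lemma dist_from_path_decreases:
  assumes C: "path_vertices T C" and y: "y \<in> V" and z: "z \<in> V"
    and neq: "closest_point T C y \<noteq> closest_point T C z"
  shows "\<exists>c\<in>C. dist c z < dist y z"
  using y neq
proof (induction "dist z y" arbitrary: y rule: less_induct)
  case less
  have "z \<noteq> y" using less.prems by auto
  with z less.prems(1) obtain p where p: "(p, y) \<in> E" "dist z y = Suc (dist z p)"
    by (rule parent_exists)
  have pV: "p \<in> V" using p edge_verts by blast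
  have lt: "dist p z < dist y z"
    using p(2) dist_sym[OF z pV] dist_sym[OF z less.prems(1)] by simp
  show ?case
  proof (cases "closest_point T C p = closest_point T C z")
    case True
    then have "closest_point T C p = p"
      using closest_point_crossing[OF C p(1)] less.prems by simp
    then have "p \<in> C" using closest_point(1)[OF C pV] by simp
    then show ?thesis using lt by blast
  next
    case False
    then obtain c where "c \<in> C" "dist c z < dist p z" using less.hyps[OF _ pV] p(2) by auto
    then show ?thesis using lt by (meson less_trans)
  qed
qed

lemma fibreD: "y \<in> fibre T C x \<Longrightarrow> y \<in> V" "y \<in> fibre T C x \<Longrightarrow> closest_point T C y = x"
  by (auto simp: fibre_def)

lemma closest_point_fixing:
  assumes C: "path_vertices T C" and g: "g \<in> Aut" "\<And>c. c \<in> C \<Longrightarrow> g c = c" and y: "y \<in> V"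
  shows "closest_point T C (g y) = closest_point T C y"
proof (rule closest_point_eqI[OF C])
  have "dist (g y) c = dist y c" if "c \<in> C" for c
    using aut_dist[OF g(1) y, of c] g(2)[OF that] that path_subset[OF C] by auto
  then show "dist (g y) (closest_point T C y) \<le> dist (g y) z" if "z \<in> C" for z
    using that closest_point[OF C y] by simp
qed (use closest_point[OF C y] autD(4)[OF g(1) y] in auto)

lemma bij_betw_fibre:
  assumes C: "path_vertices T C" and g: "g \<in> Aut" "\<And>c. c \<in> C \<Longrightarrow> g c = c"
  shows "bij_betw g (fibre T C x) (fibre T C x)"
  unfolding bij_betw_def
proof
  show "inj_on g (fibre T C x)"
    by (rule inj_onI) (use autD(6)[OF g(1)] fibreD(1) in blast)
  show "g ` fibre T C x = fibre T C x"
  proof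
    show "g ` fibre T C x \<subseteq> fibre T C x"
      using closest_point_fixing[OF C g] autD(4)[OF g(1)] by (auto simp: fibre_def)
    show "fibre T C x \<subseteq> g ` fibre T C x"
    proof
      fix y assume y: "y \<in> fibre T C x"
      then obtain z where z: "z \<in> V" "g z = y" using aut_surj[OF g(1)] fibreD(1) by metis
      then have "z \<in> fibre T C x" using closest_point_fixing[OF C g z(1)] y by (simp add: fibre_def)
      with z show "y \<in> g ` fibre T C x" by blast
    qed
  qed
qed

lemma restrict_fibre_aut:
  assumes C: "path_vertices T C" and g: "g \<in> Aut" "\<And>c. c \<in> C \<Longrightarrow> g c = c"
  shows "restrict g (fibre T C x) \<in> Bij (fibre T C x)"
  using bij_betw_fibre[OF assms] by (simp add: Bij_def cong: bij_betw_cong)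

text \<open>
An automorphism that fixes \<open>C\<close> pointwise preserves every fibre, so the pieces fit together to a
bijection. The edges between different fibres have both ends in \<open>C\<close>, where nothing moves.
\<close>

lemma glue_on_fibres:
  assumes C: "path_vertices T C"
    and h: "\<And>x. x \<in> C \<Longrightarrow> h x \<in> Aut" "\<And>x c. x \<in> C \<Longrightarrow> c \<in> C \<Longrightarrow> h x c = c"
  shows "(\<lambda>y\<in>V. h (closest_point T C y) y) \<in> Aut" (is "?g \<in> Aut")
proof -
  let ?p = "closest_point T C"
  have pC: "?p y \<in> C" if "y \<in> V" for y using closest_point(1)[OF C that] .
  have gV: "?g y \<in> V" if "y \<in> V" for y using autD(4)[OF h(1)[OF pC]] that by simp
  have pg: "?p (?g y) = ?p y" if "y \<in> V" for y
    using closest_point_fixing[OF C h(1)[OF pC] h(2)[OF pC]] that by simp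
  have gC: "?g y = y" if "y \<in> C" for y
    using h(2)[OF pC, of y y] that path_subset[OF C] by auto
  have same: "?g y = ?p y \<Longrightarrow> y = ?p y" if "y \<in> V" for y
  proof -
    assume "?g y = ?p y"
    then have "h (?p y) y = h (?p y) (?p y)" using h(2)[OF pC pC] that by simp
    then show "y = ?p y" using autD(6)[OF h(1)[OF pC]] that pC path_subset[OF C] by blast
  qed
  have "bij_betw ?g V V"
  proof (rule bij_betw_imageI)
    show "inj_on ?g V"
    proof (rule inj_onI)
      fix y z assume yz: "y \<in> V" "z \<in> V" "?g y = ?g z"
      then have "?p y = ?p z" using pg by metis
      with yz show "y = z" using autD(6)[OF h(1)[OF pC]] by auto
    qed
    show "?g ` V = V"
    proof
      show "?g ` V \<subseteq> V" using gV by blast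
      show "V \<subseteq> ?g ` V"
      proof
        fix y assume y: "y \<in> V"
        obtain z where z: "z \<in> V" "h (?p y) z = y" using aut_surj[OF h(1)[OF pC[OF y]] y] .
        then have "?p z = ?p y" using closest_point_fixing[OF C h(1)[OF pC[OF y]] h(2)[OF pC[OF y]] z(1)]
          by simp
        then have "?g z = y" using z by simp
        with z show "y \<in> ?g ` V" by blast
      qed
    qed
  qed
  moreover have "(?g u, ?g v) \<in> E \<longleftrightarrow> (u, v) \<in> E" if uv: "u \<in> V" "v \<in> V" for u v
  proof (cases "?p u = ?p v")
    case True
    then show ?thesis using autD(5)[OF h(1)[OF pC[OF uv(1)]] uv] uv by simp
  next
    case False
    have "u = ?p u \<and> v = ?p v" if "(?g u, ?g v) \<in> E"
    proof -
      have p: "?p (?g u) = ?p u" "?p (?g v) = ?p v" using pg uv by blast+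
      then have "?p u = ?g u \<and> ?p v = ?g v"
        using closest_point_crossing[OF C that] False by simp
      then show ?thesis using same[OF uv(1)] same[OF uv(2)] by simp
    qed
    moreover have "u = ?p u \<and> v = ?p v" if "(u, v) \<in> E"
      using closest_point_crossing[OF C that False] by simp
    moreover have "?g u = u \<and> ?g v = v" if "u = ?p u \<and> v = ?p v"
      using gC[of u] gC[of v] pC[OF uv(1)] pC[OF uv(2)] that by simp
    ultimately have "(?g u, ?g v) \<in> E \<Longrightarrow> (u, v) \<in> E" "(u, v) \<in> E \<Longrightarrow> (?g u, ?g v) \<in> E"
      by metis+
    then show ?thesis by (rule iffI)
  qed
  ultimately show ?thesis unfolding graph_auts_def Bij_def by auto
qed

end

context tree_subgroup
begin

lemma fixator_thickenD:
  assumes "path_vertices T C" "h \<in> fixator H (thicken T C j)"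
  shows "h \<in> H" "h \<in> Aut" "c \<in> C \<Longrightarrow> h c = c"
    and "c \<in> C \<Longrightarrow> y \<in> V \<Longrightarrow> dist c y \<le> j \<Longrightarrow> h y = y"
  using assms path_subset[OF assms(1)] H_aut by (force simp: fixator_def thicken_def)+

lemma k_closed_imp_property_P:
  assumes k: "1 \<le> k" and closed: "k_closed k H"
  shows "property_P k T H"
  unfolding property_P_def
proof (intro allI impI)
  fix C assume C: "path_vertices T C"
  let ?K = "fixator H (thicken T C (k - 1))" and ?S = "fibre T C" and ?p = "closest_point T C"
  note KD = fixator_thickenD[OF C]
  let ?G = "fixator_group T H C (k - 1)" and ?P = "product_group C (induced_group T H C (k - 1))"
  have carG: "carrier ?G = ?K" by (simp add: fixator_group_def)
  have carP: "carrier ?P = (\<Pi>\<^sub>E x\<in>C. (\<lambda>h. restrict h (?S x)) ` ?K)"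
    by (simp add: induced_group_def cong: PiE_cong)
  have "restriction_map T C \<in> hom ?G ?P"
  proof (rule homI)
    fix h assume "h \<in> carrier ?G"
    then show "restriction_map T C h \<in> carrier ?P"
      unfolding carG carP restriction_map_def by (auto intro!: restrict_PiE_iff[THEN iffD2])
  next
    fix g h assume "g \<in> carrier ?G" "h \<in> carrier ?G"
    then have gh: "g \<in> ?K" "h \<in> ?K" by (simp_all only: carG)
    have m: "g \<otimes>\<^bsub>?G\<^esub> h = compose V g h"
      using aut_mult[of g h] KD(2) gh by (simp add: fixator_group_def)
    have "restrict (compose V g h) (?S x) =
        restrict g (?S x) \<otimes>\<^bsub>induced_group T H C (k - 1) x\<^esub> restrict h (?S x)" for x
    proof -
      have B: "restrict g (?S x) \<in> Bij (?S x)" "restrict h (?S x) \<in> Bij (?S x)"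
        using restrict_fibre_aut[OF C] KD(2,3) gh by blast+
      have "h y \<in> ?S x" if "y \<in> ?S x" for y
        using B(2) that by (auto simp: Bij_def dest: bij_betwE)
      then show ?thesis using B
        by (auto simp: induced_group_def aut_group_def BijGroup_def spanned_def compose_def
            fun_eq_iff dest: fibreD)
    qed
    then show "restriction_map T C (g \<otimes>\<^bsub>?G\<^esub> h) = restriction_map T C g \<otimes>\<^bsub>?P\<^esub> restriction_map T C h"
      unfolding m by (auto simp: restriction_map_def)
  qed
  moreover have "inj_on (restriction_map T C) ?K"
  proof (rule inj_onI)
    fix g h assume gh: "g \<in> ?K" "h \<in> ?K" "restriction_map T C g = restriction_map T C h"
    show "g = h"
    proof (rule aut_eqI)
      fix y assume y: "y \<in> V"
      have "restriction_map T C g (?p y) y = restriction_map T C h (?p y) y" using gh(3) by simp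
      then show "g y = h y" using closest_point(1)[OF C y] y
        by (simp add: restriction_map_def fibre_def)
    qed (use gh KD(2) in auto)
  qed
  moreover have "carrier ?P \<subseteq> restriction_map T C ` ?K"
  proof
    fix f assume "f \<in> carrier ?P"
    then have f: "f \<in> (\<Pi>\<^sub>E x\<in>C. (\<lambda>h. restrict h (?S x)) ` ?K)" by (simp only: carP)
    have "\<forall>x\<in>C. \<exists>h. h \<in> ?K \<and> f x = restrict h (?S x)" using PiE_mem[OF f] by blast
    then obtain h where h: "\<And>x. x \<in> C \<Longrightarrow> h x \<in> ?K" "\<And>x. x \<in> C \<Longrightarrow> f x = restrict (h x) (?S x)"
      by metis
    define g where "g = (\<lambda>y\<in>V. h (?p y) y)"
    have gA: "g \<in> Aut"
      unfolding g_def by (rule glue_on_fibres[OF C]) (rule KD(2)[OF h(1)] KD(3)[OF h(1)]; assumption)+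
    have pC: "?p y \<in> C" if "y \<in> V" for y using closest_point(1)[OF C that] .
    have fix_thick: "g y = y" if "y \<in> V" "c \<in> C" "dist c y \<le> k - 1" for c y
      using KD(4)[OF h(1)[OF pC[OF that(1)]] that(2,1,3)] that(1) by (simp add: g_def)
    \<comment> \<open>Off its own fibre, the ball around \<open>y\<close> is contained in the thickened path, on which every \<open>h x\<close> is trivial.\<close>
    have "locally_in k H g"
      unfolding locally_in_def
    proof
      fix y assume y: "y \<in> V"
      have "g z = h (?p y) z" if z: "z \<in> V" "dist y z \<le> k" for z
      proof (cases "?p y = ?p z")
        case False
        then obtain c where c: "c \<in> C" "dist c z < dist y z"
          using dist_from_path_decreases[OF C y z(1)] by blast
        then have "dist c z \<le> k - 1" using z by simp
        then show ?thesis using fix_thick[OF z(1) c(1)] KD(4)[OF h(1)[OF pC[OF y]] c(1) z(1)] by simp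
      qed (use z in \<open>simp add: g_def\<close>)
      then show "\<exists>h\<in>H. \<forall>z\<in>V. dist y z \<le> k \<longrightarrow> g z = h z"
        using KD(1)[OF h(1)[OF pC[OF y]]] by blast
    qed
    then have "g \<in> H" using closed gA unfolding k_closed_def by blast
    then have "g \<in> ?K" using fix_thick by (auto simp: fixator_def thicken_def)
    moreover have "restriction_map T C g = f"
    proof (rule extensionalityI[of _ C])
      show "f \<in> extensional C" using f by (simp add: PiE_def)
    qed (auto simp: restriction_map_def h(2) g_def fibre_def fun_eq_iff)
    ultimately show "f \<in> restriction_map T C ` ?K" by blast
  qed
  moreover have "restriction_map T C ` ?K \<subseteq> carrier ?P"
    using hom_carrier[OF calculation(1)] unfolding carG .
  ultimately show "restriction_map T C \<in> iso ?G ?P"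
    unfolding iso_def bij_betw_def carG by blast
qed

end

section \<open>From the independence property of edges to local membership\<close>

context regular_tree_graph
begin

text \<open>
Finite subtrees containing \<open>x\<close>, built by adding leaves; the induction principle is what the
approximation argument uses.
\<close>

inductive rooted_subtree :: "'v \<Rightarrow> 'v set \<Rightarrow> bool" for x where
  root: "rooted_subtree x {x}"
| leaf: "rooted_subtree x S \<Longrightarrow> p \<in> S \<Longrightarrow> (p, s) \<in> E \<Longrightarrow> dist x s = Suc (dist x p) \<Longrightarrow>
    rooted_subtree x (insert s S)"

lemma rooted_subtree_verts: "rooted_subtree x S \<Longrightarrow> x \<in> V \<Longrightarrow> x \<in> S \<and> S \<subseteq> V"
  by (induction rule: rooted_subtree.induct) (auto dest: edge_verts)

text \<open>
Removing the edge from \<open>p\<close> to \<open>s\<close> separates \<open>s\<close> from \<open>x\<close>, and a subtree that does not contain \<open>s\<close> cannot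
cross it: by \<open>closest_point_crossing\<close>, the only edge across is \<open>(p, s)\<close> itself.
\<close>

lemma rooted_subtree_behind_parent:
  assumes "rooted_subtree x S" "x \<in> V" "(p, s) \<in> E" "dist x s = Suc (dist x p)" "s \<notin> S" "t \<in> S"
  shows "dist t p < dist t s"
  using assms(1,5,6)
proof (induction arbitrary: t rule: rooted_subtree.induct)
  case root
  then show ?case using assms(4) by simp
next
  case (leaf S p' s')
  show ?case
  proof (cases "t = s'")
    case True
    have V: "p' \<in> V" "s' \<in> V" using leaf.hyps(3) edge_verts by auto
    have "dist p' p < dist p' s" using leaf.IH leaf.prems(1) leaf.hyps(2) by blast
    then have p': "closest_point T {p, s} p' = p" by (simp add: closest_point_edge[OF assms(3) V(1)])
    show ?thesis
    proof (rule ccontr)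
      assume "\<not> ?thesis"
      then have s': "closest_point T {p, s} s' = s"
        by (simp add: closest_point_edge[OF assms(3) V(2)] True)
      then have "s = s'"
        using closest_point_crossing[OF edge_path_vertices[OF assms(3)] leaf.hyps(3)] p'
          edge_irrefl[OF assms(3)] by simp
      with leaf.prems show False by simp
    qed
  qed (use leaf in blast)
qed

lemma rooted_subtree_extend:
  assumes "rooted_subtree x S" "x \<in> V" "y \<in> V"
  shows "\<exists>S'. rooted_subtree x S' \<and> insert y S \<subseteq> S'"
  using assms(3)
proof (induction "dist x y" arbitrary: y rule: less_induct)
  case less
  show ?case
  proof (cases "x = y")
    case True
    then show ?thesis using assms rooted_subtree_verts by blast
  next
    case False
    with assms(2) less.prems obtain p where p: "(p, y) \<in> E" "dist x y = Suc (dist x p)"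
      by (rule parent_exists)
    then obtain S' where "rooted_subtree x S'" "insert p S \<subseteq> S'"
      using less.hyps[of p] edge_verts by auto
    then have "rooted_subtree x (insert y S')" "insert y S \<subseteq> insert y S'"
      using rooted_subtree.leaf[OF _ _ p] by auto
    then show ?thesis by blast
  qed
qed

lemma finite_subset_rooted_subtree:
  assumes "finite A" "A \<subseteq> V" "x \<in> V"
  shows "\<exists>S. rooted_subtree x S \<and> A \<subseteq> S"
  using assms(1,2)
proof (induction rule: finite_induct)
  case empty
  then show ?case using rooted_subtree.root by blast
next
  case (insert a A)
  then obtain S where "rooted_subtree x S" "A \<subseteq> S" by auto
  then show ?case using rooted_subtree_extend[OF _ assms(3), of S a] insert.prems by blast
qed

text \<open>
The image of an edge is determined by the images of its two ends, so every subbasic open set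
constrains at most two vertices.
\<close>

lemma open_contains_pointwise_neighbourhood:
  assumes "openin (permutation_topology T) U" "g \<in> U"
  shows "\<exists>A. finite A \<and> A \<subseteq> V \<and> (\<forall>f\<in>Aut. (\<forall>a\<in>A. f a = g a) \<longrightarrow> f \<in> U)"
proof -
  define B where "B = {{g \<in> Aut. g x = y} | x y. x \<in> V \<and> y \<in> V} \<union>
      {{g \<in> Aut. map_prod g g e = f} | e f. e \<in> E \<and> f \<in> E}"
  have "generate_topology_on B U"
    using assms(1) by (simp add: permutation_topology_def openin_topology_generated_by_iff B_def)
  then show ?thesis using assms(2)
  proof (induction rule: generate_topology_on.induct)
    case (Int a b)
    then obtain A A' where A: "finite A" "A \<subseteq> V" "\<And>f. f \<in> Aut \<Longrightarrow> (\<forall>x\<in>A. f x = g x) \<Longrightarrow> f \<in> a"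
      "finite A'" "A' \<subseteq> V" "\<And>f. f \<in> Aut \<Longrightarrow> (\<forall>x\<in>A'. f x = g x) \<Longrightarrow> f \<in> b"
      by (metis IntD1 IntD2)
    show ?case by (rule exI[of _ "A \<union> A'"]) (use A in auto)
  next
    case (UN K)
    then show ?case by (meson UnionE UnionI)
  next
    case (Basis s)
    from Basis(1) consider x y where "x \<in> V" "s = {g \<in> Aut. g x = y}"
      | e f where "e \<in> E" "s = {g \<in> Aut. map_prod g g e = f}" unfolding B_def by blast
    then show ?case
    proof cases
      case 1
      then show ?thesis using Basis(2) by (intro exI[of _ "{x}"]) auto
    next
      case 2
      obtain u v where e: "e = (u, v)" by (cases e)
      show ?thesis
        by (rule exI[of _ "{u, v}"]) (use 2 Basis(2) e edge_verts[of u v] in auto)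
    qed
  qed simp
qed

lemma closedin_pointwise_limit:
  assumes "closedin (permutation_topology T) H" "g \<in> Aut"
    and approx: "\<And>A. finite A \<Longrightarrow> A \<subseteq> V \<Longrightarrow> \<exists>h\<in>H. h \<in> Aut \<and> (\<forall>a\<in>A. g a = h a)"
  shows "g \<in> H"
proof (rule ccontr)
  assume "g \<notin> H"
  obtain x where "x \<in> V" using verts_nonempty by blast
  then have "g \<in> topspace (permutation_topology T)"
    using assms(2) autD(4)[OF assms(2)] unfolding permutation_topology_def topology_generated_by_topspace
    by (intro UnionI[of "{f \<in> Aut. f x = g x}"]) auto
  then obtain A where A: "finite A" "A \<subseteq> V"
    "\<forall>f\<in>Aut. (\<forall>a\<in>A. f a = g a) \<longrightarrow> f \<in> topspace (permutation_topology T) - H"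
    using open_contains_pointwise_neighbourhood[of "topspace (permutation_topology T) - H" g]
      assms(1) \<open>g \<notin> H\<close> unfolding closedin_def by blast
  obtain h where "h \<in> H" "h \<in> Aut" "\<forall>a\<in>A. g a = h a" using approx[OF A(1,2)] by blast
  then show False using A(3) by auto
qed

end

context tree_subgroup
begin

lemma fixator_thickenI:
  assumes "h \<in> H" "\<And>c y. c \<in> C \<Longrightarrow> y \<in> V \<Longrightarrow> dist c y \<le> j \<Longrightarrow> h y = y"
  shows "h \<in> fixator H (thicken T C j)"
  using assms by (auto simp: fixator_def thicken_def)

text \<open>
Surjectivity of the restriction homomorphism for a single edge, applied to \<open>h\<close> on the side of \<open>s\<close> and
the identity on the side of \<open>p\<close>.
\<close>

lemma property_P_edge:
  assumes P: "property_P k T H" and e: "(p, s) \<in> E"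
    and h: "h \<in> fixator H (thicken T {p, s} (k - 1))"
  obtains h' where "h' \<in> H" "\<And>z. z \<in> V \<Longrightarrow> dist z s < dist z p \<Longrightarrow> h' z = h z"
    "\<And>z. z \<in> V \<Longrightarrow> dist z p < dist z s \<Longrightarrow> h' z = z"
proof -
  let ?C = "{p, s}"
  have C: "path_vertices T ?C" by (rule edge_path_vertices[OF e])
  let ?K = "fixator H (thicken T ?C (k - 1))" and ?S = "fibre T ?C"
  have bij: "bij_betw (restriction_map T ?C) ?K
      (\<Pi>\<^sub>E x\<in>?C. (\<lambda>h. restrict h (?S x)) ` ?K)"
    using P C by (simp add: property_P_def iso_def fixator_group_def induced_group_def cong: PiE_cong)
  have one: "(\<lambda>x\<in>V. x) \<in> ?K" by (rule fixator_thickenI[OF H_one]) simp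
  define f where "f = (\<lambda>x\<in>?C. restrict (if x = s then h else (\<lambda>x\<in>V. x)) (?S x))"
  have "f \<in> (\<Pi>\<^sub>E x\<in>?C. (\<lambda>h. restrict h (?S x)) ` ?K)"
    using one h unfolding f_def by (intro restrict_PiE_iff[THEN iffD2]) auto
  then have "f \<in> restriction_map T ?C ` ?K" by (simp only: bij_betw_imp_surj_on[OF bij])
  then obtain h' where h': "f = restriction_map T ?C h'" "h' \<in> ?K" by (rule imageE)
  have eq: "h' z = (if x = s then h else (\<lambda>x\<in>V. x)) z" if "x \<in> ?C" "z \<in> ?S x" for x z
  proof -
    have "restriction_map T ?C h' x z = f x z" using h'(1) by simp
    then show ?thesis using that by (simp add: restriction_map_def f_def)
  qed
  show thesis
  proof (rule that)
    show "h' \<in> H" using h'(2) by (simp add: fixator_def)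
  next
    fix z assume z: "z \<in> V" "dist z s < dist z p"
    then have "z \<in> ?S s" by (simp add: fibre_def closest_point_edge[OF e])
    from eq[OF _ this] show "h' z = h z" by simp
  next
    fix z assume z: "z \<in> V" "dist z p < dist z s"
    then have "z \<in> ?S p" by (simp add: fibre_def closest_point_edge[OF e])
    from eq[OF _ this] show "h' z = z" using z edge_irrefl[OF e] by simp
  qed
qed

text \<open>
When the leaf \<open>s\<close> is attached at \<open>p\<close>, correct \<open>g\<close> by an element \<open>i\<close> of \<open>H\<close> so that it becomes trivial
within distance \<open>k\<close> of the old subtree. Some \<open>h \<in> H\<close> agrees with the corrected map near \<open>s\<close>; it is
trivial within distance \<open>k - 1\<close> of the edge \<open>(p, s)\<close>, because these vertices are within distance \<open>k\<close> of
both ends. Cutting \<open>h\<close> off behind the edge gives \<open>h' \<in> H\<close> that agrees with the corrected map near the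
enlarged subtree.
\<close>

lemma locally_in_approximation:
  assumes k: "1 \<le> k" and P: "property_P k T H" and g: "g \<in> Aut" "locally_in k H g"
    and S: "rooted_subtree x S" and x: "x \<in> V"
  shows "\<exists>h\<in>H. \<forall>t\<in>S. \<forall>z\<in>V. dist t z \<le> k \<longrightarrow> g z = h z"
  using S
proof (induction rule: rooted_subtree.induct)
  case root
  then show ?case using g(2) x unfolding locally_in_def by blast
next
  case (leaf S p s)
  have SV: "S \<subseteq> V" using rooted_subtree_verts[OF leaf.hyps(1) x] by blast
  have V: "p \<in> V" "s \<in> V" using leaf.hyps(3) edge_verts by auto
  have e: "dist s p = 1" "dist p s = 1" using dist_edge leaf.hyps(3) edge_sym by blast+
  have nbr: "dist s z \<le> Suc (dist p z)" "dist p z \<le> Suc (dist s z)" if "z \<in> V" for z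
    using dist_triangle[OF V that] dist_triangle[OF V(2,1) that] e by auto
  note C = edge_path_vertices[OF leaf.hyps(3)] and cp = closest_point_edge[OF leaf.hyps(3)]
  obtain h\<^sub>1 where h1: "h\<^sub>1 \<in> H" "\<And>t z. t \<in> S \<Longrightarrow> z \<in> V \<Longrightarrow> dist t z \<le> k \<Longrightarrow> g z = h\<^sub>1 z"
    using leaf.IH by blast
  obtain i where i: "i \<in> H" "\<And>z. z \<in> V \<Longrightarrow> i (h\<^sub>1 z) = z" "\<And>z. z \<in> V \<Longrightarrow> h\<^sub>1 (i z) = z"
    using H_inverse[OF h1(1)] by metis
  show ?case
  proof (cases "s \<in> S")
    case True
    then show ?thesis using leaf.IH by (simp add: insert_absorb)
  next
    case False
    have fix_S: "i (g z) = z" if "t \<in> S" "z \<in> V" "dist t z \<le> k" for t z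
      using h1(2)[OF that] i(2)[OF that(2)] by simp
    obtain f where f: "f \<in> H" "\<And>z. z \<in> V \<Longrightarrow> dist s z \<le> k \<Longrightarrow> g z = f z"
      using g(2) V(2) unfolding locally_in_def by blast
    define h where "h = compose V i f"
    have hH: "h \<in> H" unfolding h_def by (rule H_compose[OF i(1) f(1)])
    have h: "i (g z) = h z" if "z \<in> V" "dist s z \<le> k" for z
      using f(2)[OF that] that by (simp add: h_def compose_eq)
    have "h \<in> fixator H (thicken T {p, s} (k - 1))"
    proof (rule fixator_thickenI[OF hH])
      fix c y assume c: "c \<in> {p, s}" and y: "y \<in> V" "dist c y \<le> k - 1"
      have "dist s y \<le> k" "dist p y \<le> k" using c y(2) nbr[OF y(1)] k by auto
      then show "h y = y" using h[OF y(1)] fix_S[OF leaf.hyps(2) y(1)] by simp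
    qed
    then obtain h' where h': "h' \<in> H" "\<And>z. z \<in> V \<Longrightarrow> dist z s < dist z p \<Longrightarrow> h' z = h z"
      "\<And>z. z \<in> V \<Longrightarrow> dist z p < dist z s \<Longrightarrow> h' z = z"
      using property_P_edge[OF P leaf.hyps(3)] by metis
    \<comment> \<open>Behind the edge, whatever is near the subtree is near \<open>s\<close>; before it, whatever is near \<open>s\<close> is near \<open>p\<close>.\<close>
    have key: "i (g z) = h' z" if t: "t \<in> insert s S" and z: "z \<in> V" "dist t z \<le> k" for t z
    proof (cases "dist z s < dist z p")
      case True
      have "dist s z \<le> k"
      proof (cases "t = s")
        case False
        then have t: "t \<in> S" "t \<in> V" using t SV by auto
        have "dist t p < dist t s"
          by (rule rooted_subtree_behind_parent[OF leaf.hyps(1) x leaf.hyps(3,4) \<open>s \<notin> S\<close> t(1)])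
        then have "closest_point T {p, s} t \<noteq> closest_point T {p, s} z"
          using True edge_irrefl[OF leaf.hyps(3)] by (simp add: cp t(2) z(1))
        then obtain c where "c \<in> {p, s}" "dist c z < dist t z"
          using dist_from_path_decreases[OF C t(2) z(1)] by blast
        then show ?thesis using z(2) True dist_sym[OF z(1) V(1)] dist_sym[OF z(1) V(2)] by auto
      qed (use z in simp)
      then show ?thesis using h[OF z(1)] h'(2)[OF z(1) True] by simp
    next
      case False
      have "dist z p \<noteq> dist z s" by (rule dist_edge_cases[OF leaf.hyps(3) z(1)]) auto
      then have lt: "dist z p < dist z s" using False by simp
      have "i (g z) = z"
      proof (cases "t = s")
        case True
        then have "dist p z \<le> k" using lt z(2) dist_sym[OF z(1) V(1)] dist_sym[OF z(1) V(2)] by simp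
        then show ?thesis by (rule fix_S[OF leaf.hyps(2) z(1)])
      qed (use t z fix_S in blast)
      then show ?thesis using h'(3)[OF z(1) lt] by simp
    qed
    have "g z = compose V h\<^sub>1 h' z" if "t \<in> insert s S" "z \<in> V" "dist t z \<le> k" for t z
      using key[OF that] i(3)[OF autD(4)[OF g(1) that(2)]] that(2) by (simp add: compose_eq)
    then show ?thesis using H_compose[OF h1(1) h'(1)] by blast
  qed
qed

lemma property_P_imp_k_closed:
  assumes k: "1 \<le> k" and P: "property_P k T H" and closed: "closedin (permutation_topology T) H"
  shows "k_closed k H"
  unfolding k_closed_def
proof (intro ballI impI)
  fix g assume g: "g \<in> Aut" "locally_in k H g"
  obtain x where x: "x \<in> V" using verts_nonempty by blast
  show "g \<in> H"
  proof (rule closedin_pointwise_limit[OF closed g(1)])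
    fix A assume A: "finite A" "A \<subseteq> V"
    obtain S where S: "rooted_subtree x S" "A \<subseteq> S"
      using finite_subset_rooted_subtree[OF A x] by blast
    obtain h where h: "h \<in> H" "\<And>t z. t \<in> S \<Longrightarrow> z \<in> V \<Longrightarrow> dist t z \<le> k \<Longrightarrow> g z = h z"
      using locally_in_approximation[OF k P g S(1) x] by blast
    have "g a = h a" if "a \<in> A" for a
      using h(2)[of a a] that S(2) A(2) by auto
    with h(1) show "\<exists>h\<in>H. h \<in> Aut \<and> (\<forall>a\<in>A. g a = h a)" using H_aut by blast
  qed
qed

end

section \<open>Vertices as reduced words\<close>

text \<open>
This captures two situations at once: walks that follow the labels of a labelling, and
orbits of a group generated by involutions that move \<open>x\<close> to its neighbours. Words grow at the head, and
\<open>v (a # w)\<close> is the neighbour of \<open>v w\<close> in direction \<open>a\<close>. Reduced words, those without equal adjacent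
letters, correspond to walks without backtracking and hence to the vertices.
\<close>

locale word_parametrization = regular_tree_graph d T for d and T :: "'v pair_pre_digraph" +
  fixes \<Omega> :: "'w set" and x :: 'v and v :: "'w list \<Rightarrow> 'v"
  assumes base_vert: "x \<in> V"
    and Nil: "v [] = x"
    and nbrs: "w \<in> lists \<Omega> \<Longrightarrow> bij_betw (\<lambda>a. v (a # w)) \<Omega> {y. (v w, y) \<in> E}"
    and cancel: "a \<in> \<Omega> \<Longrightarrow> w \<in> lists \<Omega> \<Longrightarrow> v (a # a # w) = v w"
begin

abbreviation "reduced \<equiv> {w \<in> lists \<Omega>. distinct_adj w}"

lemma Cons_edge: "a \<in> \<Omega> \<Longrightarrow> w \<in> lists \<Omega> \<Longrightarrow> (v w, v (a # w)) \<in> E"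
  using bij_betwE[OF nbrs] by blast

lemma Cons_inj: "w \<in> lists \<Omega> \<Longrightarrow> a \<in> \<Omega> \<Longrightarrow> b \<in> \<Omega> \<Longrightarrow> v (a # w) = v (b # w) \<longleftrightarrow> a = b"
  using inj_on_eq_iff[OF bij_betw_imp_inj_on[OF nbrs]] by simp

lemma word_vert: "w \<in> lists \<Omega> \<Longrightarrow> v w \<in> V"
proof (induction w)
  case (Cons a w)
  then show ?case using edge_verts(2)[OF Cons_edge] by simp
qed (simp add: base_vert Nil)

text \<open>
By \<open>cancel\<close>, going in direction \<open>b\<close> from \<open>v (b # w)\<close> leads back to its parent \<open>v w\<close>, so any other
direction leads away from \<open>x\<close>.
\<close>

lemma dist_reduced_word: "w \<in> reduced \<Longrightarrow> dist x (v w) = length w"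
proof (induction w rule: induct_list012)
  case 1
  then show ?case by (simp add: Nil base_vert)
next
  case (2 a)
  then show ?case using dist_edge[OF Cons_edge[of a "[]"]] by (simp add: Nil)
next
  case (3 a b w)
  have ab: "a \<in> \<Omega>" "b \<in> \<Omega>" "w \<in> lists \<Omega>" "b # w \<in> lists \<Omega>" "a \<noteq> b" using 3(3) by auto
  have IH: "dist x (v (b # w)) = Suc (length w)" "dist x (v w) = length w"
    using 3 by (auto dest: distinct_adj_ConsD)
  have "v (a # b # w) \<noteq> v w"
    using Cons_inj[OF ab(4,1,2)] ab(5) cancel[OF ab(2,3)] by simp
  then have "dist x (v (a # b # w)) = Suc (dist x (v (b # w)))"
    using dist_away_from_parent[OF base_vert edge_sym[OF Cons_edge[OF ab(2,3)]] _ Cons_edge[OF ab(1,4)]] IH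
    by simp
  then show ?case using IH by simp
qed

lemma reduced_word_inj:
  assumes "w \<in> reduced" "w' \<in> reduced" "v w = v w'"
  shows "w = w'"
  using assms
proof (induction w arbitrary: w')
  case Nil
  then show ?case using dist_reduced_word[of w'] dist_reduced_word[of "[]"] by simp
next
  case (Cons a w)
  have "length w' = Suc (length w)"
    using dist_reduced_word[OF Cons.prems(1)] dist_reduced_word[OF Cons.prems(2)] Cons.prems(3) by simp
  then obtain b u where w': "w' = b # u" by (cases w') auto
  have r: "w \<in> reduced" "u \<in> reduced" "a \<in> \<Omega>" "b \<in> \<Omega>" "w \<in> lists \<Omega>"
    using Cons.prems w' by (auto dest: distinct_adj_ConsD)
  have "v w = v u"
  proof (rule parent_unique[OF base_vert, of "v (a # w)"])
    show "(v (a # w), v w) \<in> E" using Cons_edge edge_sym r by blast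
    show "(v (a # w), v u) \<in> E"
      using Cons_edge[of b u] edge_sym r Cons.prems(3) by (simp add: w')
    show "dist x (v w) \<le> dist x (v (a # w))" "dist x (v u) \<le> dist x (v (a # w))"
      using dist_reduced_word r Cons.prems \<open>length w' = _\<close> by (simp_all add: w')
  qed
  then have "w = u" using Cons.IH r by blast
  moreover have "a = b" using Cons_inj[OF r(5,3,4)] Cons.prems(3) by (simp add: w' \<open>w = u\<close>)
  ultimately show ?case by (simp add: w')
qed

lemma reduced_word_exists: "y \<in> V \<Longrightarrow> \<exists>w\<in>reduced. v w = y"
proof (induction "dist x y" arbitrary: y)
  case 0
  then have "x = y" using dist_eq_0_iff[OF base_vert] by simp
  then show ?case using Nil by (intro bexI[of _ "[]"]) auto
next
  case (Suc n)
  then have "x \<noteq> y" by auto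
  with base_vert Suc.prems obtain z where z: "(z, y) \<in> E" "dist x y = Suc (dist x z)"
    by (rule parent_exists)
  then obtain w where w: "w \<in> reduced" "v w = z" using Suc edge_verts(1)[OF z(1)] by auto
  then have "y \<in> (\<lambda>a. v (a # w)) ` \<Omega>"
    using bij_betw_imp_surj_on[OF nbrs[of w]] z(1) by simp
  then obtain a where a: "a \<in> \<Omega>" "v (a # w) = y" by auto
  show ?case
  proof (cases "w \<noteq> [] \<and> hd w = a")
    case True
    then obtain u where u: "w = a # u" by (cases w) auto
    then show ?thesis using a w cancel[of a u] by (intro bexI[of _ u]) (auto dest: distinct_adj_ConsD)
  next
    case False
    then show ?thesis using a w by (intro bexI[of _ "a # w"]) (auto simp: distinct_adj_Cons)
  qed
qed

lemma bij_betw_reduced_words: "bij_betw v reduced V"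
proof (rule bij_betw_imageI)
  show "inj_on v reduced" by (rule inj_onI) (rule reduced_word_inj)
  show "v ` reduced = V" using word_vert reduced_word_exists by blast
qed

lemma reduced_words_edge_iff:
  assumes w: "w \<in> reduced" "w' \<in> reduced"
  shows "(v w, v w') \<in> E \<longleftrightarrow> (\<exists>a. w' = a # w \<or> w = a # w')"
proof -
  have down: "\<exists>a. w' = a # w"
    if e: "(v w, v w') \<in> E" and d: "dist x (v w') = Suc (dist x (v w))"
      and w: "w \<in> reduced" "w' \<in> reduced" for w w'
  proof -
    obtain a u where w': "w' = a # u" using d dist_reduced_word[OF w(2)] by (cases w') auto
    have r: "u \<in> reduced" "a \<in> \<Omega>" using w w' by (auto dest: distinct_adj_ConsD)
    have "v w = v u"
    proof (rule parent_unique[OF base_vert edge_sym[OF e]])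
      show "(v w', v u) \<in> E" using Cons_edge[of a u] edge_sym r by (simp add: w')
      show "dist x (v u) \<le> dist x (v w')"
        using dist_reduced_word[OF r(1)] dist_reduced_word[OF w(2)] w' by simp
    qed (use d in simp)
    then have "w = u" using reduced_word_inj w(1) r(1) by blast
    then show ?thesis using w' by blast
  qed
  show ?thesis
  proof
    assume e: "(v w, v w') \<in> E"
    show "\<exists>a. w' = a # w \<or> w = a # w'"
      by (rule dist_edge_cases[OF e base_vert]) (use down[OF e _ w] down[OF edge_sym[OF e] _ w(2,1)] in blast)+
  next
    assume "\<exists>a. w' = a # w \<or> w = a # w'"
    then show "(v w, v w') \<in> E" using Cons_edge[of _ w] Cons_edge[of _ w'] w edge_sym by auto
  qed
qed

end

context regular_tree_graph
begin

text \<open>The labels of the walk from \<open>x\<close> are read off the word from the back.\<close>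

primrec follow :: "('v \<times> 'v \<Rightarrow> 'w) \<Rightarrow> 'v \<Rightarrow> 'w list \<Rightarrow> 'v" where
  "follow l x [] = x"
| "follow l x (a # w) = (THE y. (follow l x w, y) \<in> E \<and> l (follow l x w, y) = a)"

lemma labelling_bij:
  assumes "labelling \<Omega> T l" "x \<in> V"
  shows "bij_betw (\<lambda>y. l (x, y)) {y. (x, y) \<in> E} \<Omega>"
proof -
  have "bij_betw (Pair x) {y. (x, y) \<in> E} (out_arcs (with_proj T) x)"
    by (rule bij_betw_imageI) (auto simp: out_arcs_def inj_on_def)
  moreover have "bij_betw l (out_arcs (with_proj T) x) \<Omega>" using assms by (simp add: labelling_def)
  ultimately have "bij_betw (l \<circ> Pair x) {y. (x, y) \<in> E} \<Omega>" by (rule bij_betw_trans)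
  then show ?thesis by (simp add: comp_def)
qed

lemma labelling_swap: "labelling \<Omega> T l \<Longrightarrow> (u, v) \<in> E \<Longrightarrow> l (v, u) = l (u, v)"
  unfolding labelling_def by force

lemma labelling_inj:
  assumes "labelling \<Omega> T l" "(x, y) \<in> E" "(x, z) \<in> E" "l (x, y) = l (x, z)"
  shows "y = z"
  using inj_onD[OF bij_betw_imp_inj_on[OF labelling_bij[OF assms(1) edge_verts(1)[OF assms(2)]]] assms(4)] assms
  by simp

lemma follow_eqI:
  assumes "labelling \<Omega> T l" "(follow l x w, y) \<in> E" "l (follow l x w, y) = a"
  shows "follow l x (a # w) = y"
  unfolding follow.simps by (rule the_equality) (use assms labelling_inj[OF assms(1)] in auto)

lemma follow_Cons:
  assumes l: "labelling \<Omega> T l" and x: "x \<in> V" and "a \<in> \<Omega>" "w \<in> lists \<Omega>"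
  shows "(follow l x w, follow l x (a # w)) \<in> E \<and> l (follow l x w, follow l x (a # w)) = a"
  using assms(4,3)
proof (induction w arbitrary: a)
  case Nil
  then obtain y where "(follow l x [], y) \<in> E" "l (follow l x [], y) = a"
    using bij_betw_imp_surj_on[OF labelling_bij[OF l x]] by auto
  then show ?case using follow_eqI[OF l, of x "[]"] by metis
next
  case (Cons b w)
  have "follow l x (b # w) \<in> V" using Cons edge_verts(2) by blast
  from bij_betw_imp_surj_on[OF labelling_bij[OF l this]]
  obtain y where "(follow l x (b # w), y) \<in> E" "l (follow l x (b # w), y) = a"
    using Cons.prems by (auto simp del: follow.simps)
  then show ?case using follow_eqI[OF l, of x "b # w"] by metis
qed

lemma word_parametrization_follow:
  assumes l: "labelling \<Omega> T l" and x: "x \<in> V"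
  shows "word_parametrization d T \<Omega> x (follow l x)"
proof unfold_locales
  fix w assume w: "w \<in> lists \<Omega>"
  show "bij_betw (\<lambda>a. follow l x (a # w)) \<Omega> {y. (follow l x w, y) \<in> E}"
  proof (rule bij_betw_imageI)
    show "inj_on (\<lambda>a. follow l x (a # w)) \<Omega>"
      by (rule inj_onI) (metis follow_Cons[OF l x _ w])
    show "(\<lambda>a. follow l x (a # w)) ` \<Omega> = {y. (follow l x w, y) \<in> E}"
    proof
      show "(\<lambda>a. follow l x (a # w)) ` \<Omega> \<subseteq> {y. (follow l x w, y) \<in> E}"
        using follow_Cons[OF l x _ w] by blast
      show "{y. (follow l x w, y) \<in> E} \<subseteq> (\<lambda>a. follow l x (a # w)) ` \<Omega>"
      proof clarify
        fix y assume y: "(follow l x w, y) \<in> E"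
        have "l (follow l x w, y) \<in> \<Omega>" using bij_betwE[OF labelling_bij[OF l edge_verts(1)[OF y]]] y by blast
        then show "y \<in> (\<lambda>a. follow l x (a # w)) ` \<Omega>" using follow_eqI[OF l y refl]
          by (metis image_eqI)
      qed
    qed
  qed
next
  fix a w assume aw: "a \<in> \<Omega>" "w \<in> lists \<Omega>"
  have "(follow l x w, follow l x (a # w)) \<in> E" "l (follow l x w, follow l x (a # w)) = a"
    using follow_Cons[OF l x aw] by auto
  then show "follow l x (a # a # w) = follow l x w"
    by (intro follow_eqI[OF l]) (auto simp del: follow.simps simp: edge_sym labelling_swap[OF l])
qed (use x in auto)

lemma follow_append: "follow l x (w @ u) = follow l (follow l x u) w"
  by (induction w) auto

end

section \<open>Labelled balls are isomorphic in a unique way\<close>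

context regular_tree_graph
begin

abbreviation ball where "ball x k \<equiv> {y \<in> V. dist x y \<le> k}"

lemma ball_at_simps [simp]:
  "pverts (ball_at T x k) = ball x k"
  "parcs (ball_at T x k) = E \<inter> ball x k \<times> ball x k"
  by (simp_all add: ball_at_def spanned_def)

lemma label_iso_ballD:
  assumes "label_iso (ball_at T x k) l B lB \<phi>"
  shows "\<phi> \<in> extensional (ball x k)" "bij_betw \<phi> (ball x k) (pverts B)"
    and "u \<in> ball x k \<Longrightarrow> v \<in> ball x k \<Longrightarrow> (\<phi> u, \<phi> v) \<in> parcs B \<longleftrightarrow> (u, v) \<in> E"
    and "u \<in> ball x k \<Longrightarrow> v \<in> ball x k \<Longrightarrow> (u, v) \<in> E \<Longrightarrow> lB (\<phi> u, \<phi> v) = l (u, v)"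
  using assms unfolding label_iso_def by (auto dest: bspec[of _ _ "(u, v)"])

lemma label_iso_ballI:
  assumes "\<phi> \<in> extensional (ball x k)" "bij_betw \<phi> (ball x k) (pverts B)"
    and "\<And>u v. u \<in> ball x k \<Longrightarrow> v \<in> ball x k \<Longrightarrow> (\<phi> u, \<phi> v) \<in> parcs B \<longleftrightarrow> (u, v) \<in> E"
    and "\<And>u v. u \<in> ball x k \<Longrightarrow> v \<in> ball x k \<Longrightarrow> (u, v) \<in> E \<Longrightarrow> lB (\<phi> u, \<phi> v) = l (u, v)"
  shows "label_iso (ball_at T x k) l B lB \<phi>"
  using assms unfolding label_iso_def by auto

text \<open>
Send the end of a labelled walk from \<open>x\<close> to the end of the walk with the same labels from \<open>x'\<close>. On
reduced words this is a bijection, and adjacency, distance and labels can be read off the words.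
\<close>

lemma labelled_tree_homogeneous:
  fixes l l' :: "'v \<times> 'v \<Rightarrow> 'w"
  assumes l: "labelling \<Omega> T l" and l': "labelling \<Omega> T l'" and x: "x \<in> V" and x': "x' \<in> V"
  obtains f where "bij_betw f V V" "\<forall>y\<in>V. dist x' (f y) = dist x y"
    "\<forall>u\<in>V. \<forall>v\<in>V. (f u, f v) \<in> E \<longleftrightarrow> (u, v) \<in> E"
    "\<forall>u v. (u, v) \<in> E \<longrightarrow> l' (f u, f v) = l (u, v)"
proof -
  interpret P: word_parametrization d T \<Omega> x "follow l x" by (rule word_parametrization_follow[OF l x])
  interpret P': word_parametrization d T \<Omega> x' "follow l' x'"
    by (rule word_parametrization_follow[OF l' x'])
  define f where "f = follow l' x' \<circ> inv_into P.reduced (follow l x)"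
  have f: "f (follow l x w) = follow l' x' w" if "w \<in> P.reduced" for w
    using inv_into_f_f[OF bij_betw_imp_inj_on[OF P.bij_betw_reduced_words] that]
    by (simp add: f_def)
  have word: "\<exists>w\<in>P.reduced. follow l x w = y" if "y \<in> V" for y
    by (rule P.reduced_word_exists[OF that])
  have "bij_betw f V V"
    unfolding f_def
    by (rule bij_betw_trans[OF bij_betw_inv_into[OF P.bij_betw_reduced_words]
          P'.bij_betw_reduced_words])
  moreover have "dist x' (f y) = dist x y" if y: "y \<in> V" for y
  proof -
    obtain w where w: "w \<in> P.reduced" "follow l x w = y" using word[OF y] by blast
    then show ?thesis
      using P.dist_reduced_word[OF w(1)] P'.dist_reduced_word[OF w(1)] f[OF w(1)] by simp
  qed
  moreover have "(f u, f v) \<in> E \<longleftrightarrow> (u, v) \<in> E" if uv: "u \<in> V" "v \<in> V" for u v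
  proof -
    obtain w where w: "w \<in> P.reduced" "follow l x w = u" using word[OF uv(1)] by blast
    obtain w' where w': "w' \<in> P.reduced" "follow l x w' = v" using word[OF uv(2)] by blast
    note w = w w'
    have "(f u, f v) \<in> E \<longleftrightarrow> (\<exists>a. w' = a # w \<or> w = a # w')"
      unfolding w(2,4)[symmetric] f[OF w(1)] f[OF w(3)] by (rule P'.reduced_words_edge_iff[OF w(1,3)])
    also have "\<dots> \<longleftrightarrow> (u, v) \<in> E"
      unfolding w(2,4)[symmetric] by (rule P.reduced_words_edge_iff[OF w(1,3), symmetric])
    finally show ?thesis .
  qed
  moreover have "l' (f u, f v) = l (u, v)" if e: "(u, v) \<in> E" for u v
  proof -
    obtain w where w: "w \<in> P.reduced" "follow l x w = u" using word[OF edge_verts(1)[OF e]] by blast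
    obtain w' where w': "w' \<in> P.reduced" "follow l x w' = v" using word[OF edge_verts(2)[OF e]] by blast
    note w = w w'
    have up: "l' (f y, f z) = l (y, z) \<and> l' (f z, f y) = l (z, y)"
      if w: "w \<in> P.reduced" "a # w \<in> P.reduced" "follow l x w = y" "follow l x (a # w) = z"
      for y z a w
    proof -
      have aw: "a \<in> \<Omega>" "w \<in> lists \<Omega>" using w by auto
      have eq: "f y = follow l' x' w" "f z = follow l' x' (a # w)"
        using f[OF w(1)] f[OF w(2)] unfolding w(3,4) by auto
      have "(y, z) \<in> E" "l (y, z) = a" "(f y, f z) \<in> E" "l' (f y, f z) = a"
        using follow_Cons[OF l x aw] follow_Cons[OF l' x' aw] unfolding w(3,4) eq by auto
      then show ?thesis using labelling_swap[OF l] labelling_swap[OF l'] by metis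
    qed
    obtain a where "w' = a # w \<or> w = a # w'"
      using P.reduced_words_edge_iff[OF w(1,3)] e unfolding w(2,4) by blast
    then consider "w' = a # w" | "w = a # w'" by blast
    then show ?thesis
    proof cases
      case 1
      then show ?thesis using up[of w a u v] w by simp
    next
      case 2
      then show ?thesis using up[of w' a v u] w by simp
    qed
  qed
  ultimately show thesis using that by blast
qed

lemma label_iso_ball_exists:
  assumes model: "labelled_ball_model \<Omega> T k B lB" and l: "labelling \<Omega> T l" and x: "x \<in> V"
  shows "\<exists>\<phi>. label_iso (ball_at T x k) l B lB \<phi>"
proof -
  obtain l' x' \<phi> where l': "labelling \<Omega> T l'" "x' \<in> V" and phi: "label_iso (ball_at T x' k) l' B lB \<phi>"
    using model unfolding labelled_ball_model_def by blast
  obtain f where f: "bij_betw f V V" "\<forall>y\<in>V. dist x' (f y) = dist x y"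
    "\<forall>u\<in>V. \<forall>v\<in>V. (f u, f v) \<in> E \<longleftrightarrow> (u, v) \<in> E"
    "\<forall>u v. (u, v) \<in> E \<longrightarrow> l' (f u, f v) = l (u, v)"
    by (rule labelled_tree_homogeneous[OF l l'(1) x l'(2)])
  have fV: "f y \<in> V" if "y \<in> V" for y using bij_betwE[OF f(1)] that by blast
  have ball: "bij_betw f (ball x k) (ball x' k)"
  proof (rule bij_betw_imageI)
    show "inj_on f (ball x k)" using bij_betw_imp_inj_on[OF f(1)] by (rule inj_on_subset) auto
    have "z \<in> f ` ball x k" if z: "z \<in> ball x' k" for z
    proof -
      have "z \<in> f ` V" using z by (simp add: bij_betw_imp_surj_on[OF f(1)])
      then obtain y where "z = f y" "y \<in> V" by (rule imageE)
      then show ?thesis using z f(2) by auto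
    qed
    then show "f ` ball x k = ball x' k" using f(2) fV by auto
  qed
  have fb: "f u \<in> ball x' k" if "u \<in> ball x k" for u using bij_betwE[OF ball] that by blast
  note phi = label_iso_ballD[OF phi]
  let ?\<psi> = "restrict (\<phi> \<circ> f) (ball x k)"
  have "label_iso (ball_at T x k) l B lB ?\<psi>"
  proof (rule label_iso_ballI)
    show "?\<psi> \<in> extensional (ball x k)" by (rule restrict_extensional)
    have "bij_betw (\<phi> \<circ> f) (ball x k) (pverts B)" by (rule bij_betw_trans[OF ball phi(2)])
    then show "bij_betw ?\<psi> (ball x k) (pverts B)"
      by (rule bij_betw_cong[THEN iffD1, rotated]) simp
  next
    fix u v assume uv: "u \<in> ball x k" "v \<in> ball x k"
    have eq: "?\<psi> u = \<phi> (f u)" "?\<psi> v = \<phi> (f v)" using uv by simp_all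
    have uvV: "u \<in> V" "v \<in> V" using uv by auto
    show "(?\<psi> u, ?\<psi> v) \<in> parcs B \<longleftrightarrow> (u, v) \<in> E"
      unfolding eq phi(3)[OF fb[OF uv(1)] fb[OF uv(2)]] using f(3) uvV by blast
    assume e: "(u, v) \<in> E"
    then show "lB (?\<psi> u, ?\<psi> v) = l (u, v)"
      unfolding eq using phi(4)[OF fb[OF uv(1)] fb[OF uv(2)]] f(3) f(4) uvV e by simp
  qed
  then show ?thesis by blast
qed

lemma reduced_extension:
  assumes "2 \<le> card \<Omega>" "u \<in> lists \<Omega>" "distinct_adj u"
  shows "\<exists>w. w @ u \<in> lists \<Omega> \<and> distinct_adj (w @ u) \<and> length w = n"
proof (induction n)
  case 0
  then show ?case using assms by simp
next
  case (Suc n)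
  then obtain w where w: "w @ u \<in> lists \<Omega>" "distinct_adj (w @ u)" "length w = n" by blast
  have "\<not> \<Omega> \<subseteq> {hd (w @ u)}"
    using assms(1) card_mono[of "{hd (w @ u)}" \<Omega>] by auto
  then obtain a where "a \<in> \<Omega>" "a \<noteq> hd (w @ u)" by blast
  then have "(a # w) @ u \<in> lists \<Omega> \<and> distinct_adj ((a # w) @ u) \<and> length (a # w) = Suc n"
    using w by (simp add: distinct_adj_Cons)
  then show ?case by blast
qed

text \<open>
Comparing the two maps gives a label-preserving \<open>\<theta>\<close> of the ball into itself. It carries labelled walks
from \<open>x\<close> to labelled walks from \<open>\<theta> x\<close>, so everything follows from \<open>\<theta> x = x\<close>. Otherwise, let \<open>u\<close> be the
reduced word that leads to \<open>\<theta> x\<close>. As there are at least two labels, \<open>u\<close> can be continued to a reduced word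
by \<open>k\<close> more letters. The walk from \<open>x\<close> with these \<open>k\<close> letters stays in the ball, while its image under \<open>\<theta>\<close>
ends outside, at distance \<open>k + length u\<close> from \<open>x\<close>.
\<close>

lemma label_iso_ball_unique:
  assumes card: "2 \<le> card \<Omega>" and l: "labelling \<Omega> T l" and x: "x \<in> V"
    and phi: "label_iso (ball_at T x k) l B lB \<phi>" and psi: "label_iso (ball_at T x k) l B lB \<psi>"
  shows "\<phi> = \<psi>"
proof -
  interpret P: word_parametrization d T \<Omega> x "follow l x" by (rule word_parametrization_follow[OF l x])
  note phi = label_iso_ballD[OF phi] and psi = label_iso_ballD[OF psi]
  define \<theta> where "\<theta> y = inv_into (ball x k) \<psi> (\<phi> y)" for y
  have th: "\<theta> y \<in> ball x k" "\<psi> (\<theta> y) = \<phi> y" if "y \<in> ball x k" for y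
  proof -
    have "\<phi> y \<in> \<psi> ` ball x k"
      using bij_betwE[OF phi(2)] bij_betw_imp_surj_on[OF psi(2)] that by blast
    then show "\<theta> y \<in> ball x k" "\<psi> (\<theta> y) = \<phi> y"
      unfolding \<theta>_def by (rule inv_into_into, rule f_inv_into_f)
  qed
  have xb: "x \<in> ball x k" using x by simp
  have in_ball: "follow l x w \<in> ball x k" if "w \<in> P.reduced" "length w \<le> k" for w
    using P.dist_reduced_word[OF that(1)] P.word_vert that by simp
  have follow_th: "\<theta> (follow l x w) = follow l (\<theta> x) w" if "w \<in> P.reduced" "length w \<le> k" for w
    using that
  proof (induction w)
    case (Cons a w)
    then have w: "w \<in> P.reduced" "length w \<le> k" "a \<in> \<Omega>" "w \<in> lists \<Omega>"
      by (auto dest: distinct_adj_ConsD)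
    let ?y = "follow l x w" and ?z = "follow l x (a # w)"
    have b: "?y \<in> ball x k" "?z \<in> ball x k" using in_ball w(1,2) Cons.prems by blast+
    have yz: "(?y, ?z) \<in> E" "l (?y, ?z) = a" using follow_Cons[OF l x w(3,4)] by auto
    have "(\<psi> (\<theta> ?y), \<psi> (\<theta> ?z)) \<in> parcs B"
      unfolding th(2)[OF b(1)] th(2)[OF b(2)] using phi(3)[OF b] yz(1) by blast
    then have e: "(\<theta> ?y, \<theta> ?z) \<in> E" using psi(3)[OF th(1)[OF b(1)] th(1)[OF b(2)]] by blast
    have "l (\<theta> ?y, \<theta> ?z) = a"
      using psi(4)[OF th(1)[OF b(1)] th(1)[OF b(2)] e] phi(4)[OF b yz(1)] yz(2)
      unfolding th(2)[OF b(1)] th(2)[OF b(2)] by simp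
    then show ?case using follow_eqI[OF l, of "\<theta> x" w "\<theta> ?z" a] e Cons.IH[OF w(1,2)] by simp
  qed simp
  have "\<theta> x = x"
  proof -
    obtain u where u: "u \<in> P.reduced" "follow l x u = \<theta> x"
      using P.reduced_word_exists th(1)[OF xb] by blast
    obtain w where w: "w @ u \<in> P.reduced" "length w = k"
      using reduced_extension[OF card, of u k] u(1) by blast
    then have wr: "w \<in> P.reduced" by auto
    have "follow l x (w @ u) = \<theta> (follow l x w)"
      using follow_th[OF wr] w(2) by (simp add: follow_append u(2))
    then have "dist x (follow l x (w @ u)) \<le> k" using th(1)[OF in_ball[OF wr]] w(2) by simp
    then have "u = []" using P.dist_reduced_word[OF w(1)] w(2) by simp
    then show ?thesis using u(2) by simp
  qed
  have "\<phi> y = \<psi> y" if y: "y \<in> ball x k" for y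
  proof -
    obtain w where w: "w \<in> P.reduced" "follow l x w = y" using P.reduced_word_exists y by blast
    then have "length w \<le> k" using P.dist_reduced_word[OF w(1)] y by simp
    then have "\<theta> y = y" using follow_th[OF w(1)] w(2) \<open>\<theta> x = x\<close> by simp
    then show ?thesis using th(2)[OF y] by simp
  qed
  then show ?thesis by (rule extensionalityI[OF phi(1) psi(1)])
qed

end

section \<open>Local actions\<close>

locale labelled_tree = regular_tree_graph d T for d and T :: "'v pair_pre_digraph" +
  fixes \<Omega> :: "'w set" and k :: nat and B :: "'b pair_pre_digraph" and lB :: "'b \<times> 'b \<Rightarrow> 'w"
    and l :: "'v \<times> 'v \<Rightarrow> 'w"
  assumes card_labels: "2 \<le> card \<Omega>"
    and model: "labelled_ball_model \<Omega> T k B lB"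
    and labelling: "labelling \<Omega> T l"
begin

abbreviation chart where "chart \<equiv> ball_chart T k B lB l"
abbreviation act where "act \<equiv> local_action T k B lB l"

lemma chart_label_iso: "x \<in> V \<Longrightarrow> label_iso (ball_at T x k) l B lB (chart x)"
  unfolding ball_chart_def
  using label_iso_ball_exists[OF model labelling] label_iso_ball_unique[OF card_labels labelling]
  by (metis (no_types, lifting) theI')

lemma chart_eqI: "x \<in> V \<Longrightarrow> label_iso (ball_at T x k) l B lB \<phi> \<Longrightarrow> \<phi> = chart x"
  by (rule label_iso_ball_unique[OF card_labels labelling _ _ chart_label_iso])

lemma chart_bij: "x \<in> V \<Longrightarrow> bij_betw (chart x) (ball x k) (pverts B)"
  by (rule label_iso_ballD(2)[OF chart_label_iso])

lemma chart_mem: "x \<in> V \<Longrightarrow> z \<in> ball x k \<Longrightarrow> chart x z \<in> pverts B"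
  using bij_betwE[OF chart_bij] by blast

lemma chart_inj: "x \<in> V \<Longrightarrow> z \<in> ball x k \<Longrightarrow> z' \<in> ball x k \<Longrightarrow> chart x z = chart x z' \<longleftrightarrow> z = z'"
  using inj_on_eq_iff[OF bij_betw_imp_inj_on[OF chart_bij]] by blast

lemma chart_surj:
  assumes "x \<in> V" "b \<in> pverts B"
  obtains z where "z \<in> ball x k" "chart x z = b"
proof -
  have "b \<in> chart x ` ball x k" using bij_betw_imp_surj_on[OF chart_bij[OF assms(1)]] assms(2) by simp
  then show thesis using that by (elim imageE) simp
qed

lemma aut_ball: "g \<in> Aut \<Longrightarrow> x \<in> V \<Longrightarrow> z \<in> ball x k \<Longrightarrow> g z \<in> ball (g x) k"
  by (simp add: autD(4) aut_dist)

lemma act_chart: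
  assumes "x \<in> V" "z \<in> ball x k"
  shows "act g x (chart x z) = chart (g x) (g z)"
proof -
  have "inv_into (ball x k) (chart x) (chart x z) = z"
    by (rule inv_into_f_f[OF bij_betw_imp_inj_on[OF chart_bij[OF assms(1)]] assms(2)])
  then show ?thesis using chart_mem[OF assms] by (simp add: local_action_def)
qed

lemma act_extensional: "act g x \<in> extensional (pverts B)"
  by (simp add: local_action_def)

lemma act_eqI:
  assumes "x \<in> V" "f \<in> extensional (pverts B)"
    and "\<And>z. z \<in> ball x k \<Longrightarrow> chart (g x) (g z) = f (chart x z)"
  shows "act g x = f"
proof (rule extensionalityI[OF act_extensional assms(2)])
  fix b assume "b \<in> pverts B"
  then obtain z where z: "z \<in> ball x k" "chart x z = b" using chart_surj[OF assms(1)] by blast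
  then show "act g x b = f b" using act_chart[OF assms(1) z(1), of g] assms(3)[OF z(1)] by simp
qed

lemma act_local:
  assumes x: "x \<in> V" and eq: "\<And>z. z \<in> ball x k \<Longrightarrow> g z = h z"
  shows "act g x = act h x"
proof (rule act_eqI[OF x act_extensional])
  fix z assume z: "z \<in> ball x k"
  have "g x = h x" using eq x by simp
  then show "chart (g x) (g z) = act h x (chart x z)"
    using act_chart[OF x z, of h] eq[OF z] by simp
qed

text \<open>
With the image of \<open>x\<close> given, the local action records the whole restriction to the ball, since charts are
injective.
\<close>

lemma act_determines:
  assumes g: "g \<in> Aut" "h \<in> Aut" and x: "x \<in> V" and eq: "act g x = act h x" "g x = h x"
    and z: "z \<in> ball x k"
  shows "g z = h z"
proof -
  have "chart (g x) (g z) = chart (g x) (h z)"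
    using act_chart[OF x z, of g] act_chart[OF x z, of h] eq by simp
  then show ?thesis
    using chart_inj[of "g x" "g z" "h z"] aut_ball[OF g(1) x z] aut_ball[OF g(2) x z] autD(4)[OF g(1) x] eq(2)
    by simp
qed

lemma act_aut:
  assumes g: "g \<in> Aut" and x: "x \<in> V"
  shows "act g x \<in> graph_auts B"
proof -
  have gx: "g x \<in> V" using autD(4)[OF g x] .
  have mem: "act g x b \<in> pverts B" if b: "b \<in> pverts B" for b
  proof -
    obtain z where z: "z \<in> ball x k" "chart x z = b" using chart_surj[OF x b] .
    then show ?thesis using act_chart[OF x z(1), of g] chart_mem[OF gx aut_ball[OF g x z(1)]] by simp
  qed
  have "bij_betw (act g x) (pverts B) (pverts B)"
  proof (rule bij_betw_imageI)
    show "inj_on (act g x) (pverts B)"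
    proof (rule inj_onI)
      fix b b' assume b: "b \<in> pverts B" "b' \<in> pverts B" "act g x b = act g x b'"
      obtain z where z: "z \<in> ball x k" "chart x z = b" using chart_surj[OF x b(1)] .
      obtain z' where z': "z' \<in> ball x k" "chart x z' = b'" using chart_surj[OF x b(2)] .
      have "chart (g x) (g z) = chart (g x) (g z')"
        using b(3) act_chart[OF x z(1), of g] act_chart[OF x z'(1), of g] z(2) z'(2) by simp
      then have "g z = g z'"
        using chart_inj[OF gx aut_ball[OF g x z(1)] aut_ball[OF g x z'(1)]] by blast
      then have "z = z'" using autD(6)[OF g] z(1) z'(1) by simp
      then show "b = b'" using z(2) z'(2) by simp
    qed
    show "act g x ` pverts B = pverts B"
    proof
      show "act g x ` pverts B \<subseteq> pverts B" using mem by blast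
      show "pverts B \<subseteq> act g x ` pverts B"
      proof
        fix b assume "b \<in> pverts B"
        then obtain y where y: "y \<in> ball (g x) k" "chart (g x) y = b" using chart_surj[OF gx] by blast
        have "y \<in> V" using y(1) by simp
        then obtain z where z: "z \<in> V" "g z = y" using aut_surj[OF g] by blast
        then have zb: "z \<in> ball x k" using y(1) aut_dist[OF g x z(1)] by simp
        show "b \<in> act g x ` pverts B"
          by (rule image_eqI[of _ _ "chart x z"]) (use act_chart[OF x zb, of g] y z chart_mem[OF x zb] in auto)
      qed
    qed
  qed
  moreover have "(act g x b, act g x b') \<in> parcs B \<longleftrightarrow> (b, b') \<in> parcs B"
    if b: "b \<in> pverts B" "b' \<in> pverts B" for b b'
  proof -
    obtain z where z: "z \<in> ball x k" "chart x z = b" using chart_surj[OF x b(1)] .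
    obtain z' where z': "z' \<in> ball x k" "chart x z' = b'" using chart_surj[OF x b(2)] .
    have zV: "z \<in> V" "z' \<in> V" using z(1) z'(1) by auto
    have "act g x b = chart (g x) (g z)" "act g x b' = chart (g x) (g z')"
      using act_chart[OF x z(1), of g] act_chart[OF x z'(1), of g] z(2) z'(2) by simp_all
    then show ?thesis
      using label_iso_ballD(3)[OF chart_label_iso[OF gx] aut_ball[OF g x z(1)] aut_ball[OF g x z'(1)]]
        label_iso_ballD(3)[OF chart_label_iso[OF x] z(1) z'(1)] autD(5)[OF g zV] z(2) z'(2) by simp
  qed
  ultimately show ?thesis using act_extensional unfolding graph_auts_def Bij_def by simp
qed

text \<open>
The cocycle identity of local actions.
\<close>

lemma act_compose:
  assumes g: "g \<in> Aut" "h \<in> Aut" and x: "x \<in> V"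
  shows "act (compose V g h) x = compose (pverts B) (act g (h x)) (act h x)"
proof (rule act_eqI[OF x])
  fix z assume z: "z \<in> ball x k"
  then have zV: "z \<in> V" by simp
  show "chart (compose V g h x) (compose V g h z) =
      compose (pverts B) (act g (h x)) (act h x) (chart x z)"
    using act_chart[OF x z, of h] act_chart[OF autD(4)[OF g(2) x] aut_ball[OF g(2) x z], of g]
      chart_mem[OF x z] x zV by (simp add: compose_eq)
qed simp

lemma act_inverse:
  assumes g: "g \<in> Aut" "h \<in> Aut" "\<And>z. z \<in> V \<Longrightarrow> h (g z) = z" and x: "x \<in> V"
  shows "compose (pverts B) (act h (g x)) (act g x) = (\<lambda>b\<in>pverts B. b)"
proof -
  have "act (compose V h g) x = (\<lambda>b\<in>pverts B. b)"
    by (rule act_eqI[OF x]) (use chart_mem[OF x] g(3) x in \<open>auto simp: compose_eq\<close>)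
  then show ?thesis using act_compose[OF g(2,1) x] by simp
qed

text \<open>
For label-preserving \<open>g\<close>, the chart at \<open>g x\<close> composed with \<open>g\<close> is a label-respecting isomorphism on
the ball around \<open>x\<close>, so it is the chart at \<open>x\<close>.
\<close>

lemma act_label_preserving:
  assumes g: "g \<in> Aut" and lp: "\<And>u v. (u, v) \<in> E \<Longrightarrow> l (g u, g v) = l (u, v)" and x: "x \<in> V"
  shows "act g x = (\<lambda>b\<in>pverts B. b)"
proof -
  have gx: "g x \<in> V" using autD(4)[OF g x] .
  note C = label_iso_ballD[OF chart_label_iso[OF gx]] and gb = aut_ball[OF g x]
  let ?\<phi> = "restrict (chart (g x) \<circ> g) (ball x k)"
  have ball: "bij_betw g (ball x k) (ball (g x) k)"
  proof (rule bij_betw_imageI)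
    show "inj_on g (ball x k)"
      using bij_betw_imp_inj_on[OF autD(2)[OF g]] by (rule inj_on_subset) auto
    have "y \<in> g ` ball x k" if y: "y \<in> ball (g x) k" for y
    proof -
      have "y \<in> V" using y by simp
      then obtain z where "z \<in> V" "g z = y" using aut_surj[OF g] by blast
      then show ?thesis using y aut_dist[OF g x, of z] by auto
    qed
    then show "g ` ball x k = ball (g x) k" using gb by blast
  qed
  have "label_iso (ball_at T x k) l B lB ?\<phi>"
  proof (rule label_iso_ballI)
    show "?\<phi> \<in> extensional (ball x k)" by (rule restrict_extensional)
    have "bij_betw (chart (g x) \<circ> g) (ball x k) (pverts B)" by (rule bij_betw_trans[OF ball C(2)])
    then show "bij_betw ?\<phi> (ball x k) (pverts B)"
      by (rule bij_betw_cong[THEN iffD1, rotated]) simp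
  next
    fix u v assume uv: "u \<in> ball x k" "v \<in> ball x k"
    have eq: "?\<phi> u = chart (g x) (g u)" "?\<phi> v = chart (g x) (g v)" using uv by simp_all
    have uvV: "u \<in> V" "v \<in> V" using uv by auto
    show "(?\<phi> u, ?\<phi> v) \<in> parcs B \<longleftrightarrow> (u, v) \<in> E"
      unfolding eq C(3)[OF gb[OF uv(1)] gb[OF uv(2)]] by (rule autD(5)[OF g uvV])
    assume e: "(u, v) \<in> E"
    show "lB (?\<phi> u, ?\<phi> v) = l (u, v)"
      unfolding eq C(4)[OF gb[OF uv(1)] gb[OF uv(2)] aut_edge[OF g e]] by (rule lp[OF e])
  qed
  then have chart: "?\<phi> = chart x" by (rule chart_eqI[OF x])
  show ?thesis
  proof (rule act_eqI[OF x])
    fix z assume z: "z \<in> ball x k"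
    have "chart (g x) (g z) = chart x z" unfolding chart[symmetric] using z by simp
    then show "chart (g x) (g z) = (\<lambda>b\<in>pverts B. b) (chart x z)" using chart_mem[OF x z] by simp
  qed simp
qed

lemma universal_group_k_closed: "k_closed k (universal_group T k B lB l F)"
  unfolding k_closed_def
proof (intro ballI impI)
  fix g assume g: "g \<in> Aut" "locally_in k (universal_group T k B lB l F) g"
  have "act g x \<in> F" if x: "x \<in> V" for x
  proof -
    obtain h where h: "h \<in> universal_group T k B lB l F" "\<And>y. y \<in> V \<Longrightarrow> dist x y \<le> k \<Longrightarrow> g y = h y"
      using g(2) x unfolding locally_in_def by blast
    have "act g x = act h x" by (rule act_local[OF x]) (use h(2) in auto)
    then show ?thesis using h(1) x by (simp add: universal_group_def)
  qed
  with g(1) show "g \<in> universal_group T k B lB l F" by (simp add: universal_group_def)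
qed

end

section \<open>A labelling preserved by a vertex-transitive subgroup\<close>

context tree_subgroup
begin

text \<open>
The new involution is the conjugate of \<open>t\<close> by an element that fixes \<open>x\<close> and moves \<open>y\<close> to \<open>z\<close>.
\<close>

lemma involutive_inversion_at_vertex:
  assumes lt: "locally_transitive T H" and t: "t \<in> H" "(x, y) \<in> E" "t x = y" "\<And>u. u \<in> V \<Longrightarrow> t (t u) = u"
    and z: "(x, z) \<in> E"
  shows "\<exists>s\<in>H. s x = z \<and> (\<forall>u\<in>V. s (s u) = u)"
proof -
  have V: "x \<in> V" "y \<in> V" "z \<in> V" using t(2) z edge_verts by auto
  have "(x, y) \<in> out_arcs (with_proj T) x" "(x, z) \<in> out_arcs (with_proj T) x"
    using t(2) z by (auto simp: out_arcs_def)
  with lt V(1) have "\<exists>h\<in>H. h x = x \<and> map_prod h h (x, y) = (x, z)"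
    unfolding locally_transitive_def by blast
  then obtain h where h: "h \<in> H" "h x = x" "h y = z" by auto
  obtain i where i: "i \<in> H" "\<And>u. u \<in> V \<Longrightarrow> i (h u) = u" "\<And>u. u \<in> V \<Longrightarrow> h (i u) = u"
    using H_inverse[OF h(1)] by metis
  define s where "s = compose V h (compose V t i)"
  have sH: "s \<in> H" unfolding s_def by (intro H_compose h i t)
  have s: "s u = h (t (i u))" if "u \<in> V" for u using that by (simp add: s_def compose_eq)
  have iV: "i u \<in> V" "t u \<in> V" "s u \<in> V" if "u \<in> V" for u
    using autD(4)[OF H_aut[OF i(1)] that] autD(4)[OF H_aut[OF t(1)] that] autD(4)[OF H_aut[OF sH] that]
    by auto
  have "s (s u) = u" if u: "u \<in> V" for u
  proof -
    have "i (s u) = t (i u)" using i(2)[OF iV(2)[OF iV(1)[OF u]]] by (simp add: s[OF u])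
    then show ?thesis using s[OF iV(3)[OF u]] t(4)[OF iV(1)[OF u]] i(3)[OF u] by simp
  qed
  moreover have "i x = x" using i(2)[OF V(1)] h(2) by simp
  then have "s x = z" using s[OF V(1)] t(3) h(3) by simp
  ultimately show ?thesis using sH by blast
qed

text \<open>
The first letter acts first, although the word grows there. Thus \<open>x\<close> moves under \<open>a # w\<close> to the image
under \<open>w\<close> of the neighbour \<open>t a x\<close>, which is a neighbour of the image of \<open>x\<close>: prolonging a word prolongs
the walk of \<open>x\<close>.
\<close>

primrec word_action :: "('w \<Rightarrow> 'a \<Rightarrow> 'a) \<Rightarrow> 'w list \<Rightarrow> 'a \<Rightarrow> 'a" where
  "word_action t [] = (\<lambda>y\<in>V. y)"
| "word_action t (a # w) = compose V (word_action t w) (t a)"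

lemma word_action_mem: "(\<And>a. a \<in> \<Omega> \<Longrightarrow> t a \<in> H) \<Longrightarrow> w \<in> lists \<Omega> \<Longrightarrow> word_action t w \<in> H"
  by (induction w) (auto intro: H_one H_compose)

end

locale involutive_generators = tree_subgroup d T H
  for d and T :: "'v pair_pre_digraph" and H +
  fixes \<Omega> :: "'w set" and x :: 'v and t :: "'w \<Rightarrow> 'v \<Rightarrow> 'v"
  assumes base: "x \<in> V"
    and gen: "a \<in> \<Omega> \<Longrightarrow> t a \<in> H"
    and gen_involutive: "a \<in> \<Omega> \<Longrightarrow> u \<in> V \<Longrightarrow> t a (t a u) = u"
    and gen_nbrs: "bij_betw (\<lambda>a. t a x) \<Omega> {y. (x, y) \<in> E}"
begin

abbreviation \<gamma> where "\<gamma> \<equiv> word_action t"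

lemma \<gamma>_H: "w \<in> lists \<Omega> \<Longrightarrow> \<gamma> w \<in> H"
  by (rule word_action_mem[OF gen])

lemma \<gamma>_aut: "w \<in> lists \<Omega> \<Longrightarrow> \<gamma> w \<in> Aut"
  by (rule H_aut[OF \<gamma>_H])

lemma gen_vert: "a \<in> \<Omega> \<Longrightarrow> u \<in> V \<Longrightarrow> t a u \<in> V"
  by (rule autD(4)[OF H_aut[OF gen]])

lemma \<gamma>_append: "w \<in> lists \<Omega> \<Longrightarrow> u \<in> V \<Longrightarrow> \<gamma> (w @ w') u = \<gamma> w' (\<gamma> w u)"
proof (induction w arbitrary: u)
  case (Cons a w)
  then have a: "a \<in> \<Omega>" "w \<in> lists \<Omega>" by auto
  show ?case using Cons.IH[OF a(2) gen_vert[OF a(1) Cons.prems(2)]] Cons.prems(2) by (simp add: compose_eq)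
qed simp

lemma \<gamma>_cancel:
  assumes "a \<in> \<Omega>" "w \<in> lists \<Omega>"
  shows "\<gamma> (a # a # w) = \<gamma> w"
proof (rule aut_eqI)
  show "\<gamma> (a # a # w) \<in> Aut" "\<gamma> w \<in> Aut" using assms by (auto intro!: \<gamma>_aut simp del: word_action.simps)
  fix u assume "u \<in> V"
  then show "\<gamma> (a # a # w) u = \<gamma> w u"
    using gen_vert[OF assms(1)] gen_involutive[OF assms(1)] by (simp add: compose_eq)
qed

sublocale word_parametrization d T \<Omega> x "\<lambda>w. \<gamma> w x"
proof unfold_locales
  fix w assume w: "w \<in> lists \<Omega>"
  have "bij_betw (\<gamma> w) {y. (x, y) \<in> E} {y. (\<gamma> w x, y) \<in> E}"
  proof (rule bij_betw_imageI)
    show "inj_on (\<gamma> w) {y. (x, y) \<in> E}"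
      using bij_betw_imp_inj_on[OF autD(2)[OF \<gamma>_aut[OF w]]]
      by (rule inj_on_subset) (use edge_verts(2) in blast)
    show "\<gamma> w ` {y. (x, y) \<in> E} = {y. (\<gamma> w x, y) \<in> E}"
    proof
      show "\<gamma> w ` {y. (x, y) \<in> E} \<subseteq> {y. (\<gamma> w x, y) \<in> E}"
        using aut_edge[OF \<gamma>_aut[OF w]] by blast
      show "{y. (\<gamma> w x, y) \<in> E} \<subseteq> \<gamma> w ` {y. (x, y) \<in> E}"
      proof
        fix y assume "y \<in> {y. (\<gamma> w x, y) \<in> E}"
        then have y: "(\<gamma> w x, y) \<in> E" by simp
        obtain z where z: "z \<in> V" "\<gamma> w z = y" using aut_surj[OF \<gamma>_aut[OF w] edge_verts(2)[OF y]] .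
        then have "(x, z) \<in> E" using autD(5)[OF \<gamma>_aut[OF w] base z(1)] y by simp
        with z show "y \<in> \<gamma> w ` {y. (x, y) \<in> E}" by blast
      qed
    qed
  qed
  from bij_betw_trans[OF gen_nbrs this]
  show "bij_betw (\<lambda>a. \<gamma> (a # w) x) \<Omega> {y. (\<gamma> w x, y) \<in> E}"
    using base by (simp add: comp_def compose_eq)
qed (use base \<gamma>_cancel in \<open>auto simp del: word_action.simps(2)\<close>)

lemma \<gamma>_reduce: "w \<in> lists \<Omega> \<Longrightarrow> \<exists>w'\<in>reduced. \<gamma> w = \<gamma> w'"
proof (induction w)
  case Nil
  then show ?case by (intro bexI[of _ "[]"]) auto
next
  case (Cons a w)
  then obtain w' where w': "w' \<in> reduced" "\<gamma> w = \<gamma> w'" by auto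
  have a: "a \<in> \<Omega>" using Cons by auto
  show ?case
  proof (cases "w' \<noteq> [] \<and> hd w' = a")
    case True
    then obtain u where u: "w' = a # u" by (cases w') auto
    then have ur: "u \<in> reduced" using w'(1) by (auto dest: distinct_adj_ConsD)
    have "\<gamma> (a # w) = \<gamma> (a # a # u)" using w'(2) u by simp
    also have "\<dots> = \<gamma> u" by (rule \<gamma>_cancel[OF a]) (use ur in simp)
    finally show ?thesis using ur by (rule bexI)
  next
    case False
    then have ar: "a # w' \<in> reduced" using w'(1) a by (auto simp: distinct_adj_Cons)
    have "\<gamma> (a # w) = \<gamma> (a # w')" using w'(2) by simp
    then show ?thesis using ar by (rule bexI)
  qed
qed

text \<open>
Every word acts like a reduced one, and reduced words are determined by the image of \<open>x\<close>.
\<close>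

lemma \<gamma>_free:
  assumes "w \<in> lists \<Omega>" "w' \<in> lists \<Omega>" "\<gamma> w x = \<gamma> w' x"
  shows "\<gamma> w = \<gamma> w'"
proof -
  from \<gamma>_reduce[OF assms(1)] obtain r where r: "\<gamma> w = \<gamma> r" "r \<in> reduced" by (rule bexE)
  from \<gamma>_reduce[OF assms(2)] obtain r' where r': "\<gamma> w' = \<gamma> r'" "r' \<in> reduced" by (rule bexE)
  have "r = r'" using reduced_word_inj[OF r(2) r'(2)] assms(3) unfolding r(1) r'(1) by simp
  then show ?thesis using r(1) r'(1) by simp
qed

text \<open>
The edge labelling of the Cayley graph of the group generated by the involutions, transported
to the tree by the orbit map of \<open>x\<close>.
\<close>

definition orbit_labelling :: "'v \<times> 'v \<Rightarrow> 'w" where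
  "orbit_labelling e = (SOME a. a \<in> \<Omega> \<and> (\<exists>w\<in>lists \<Omega>. e = (\<gamma> w x, \<gamma> (a # w) x)))"

text \<open>
The label does not depend on the word, since the image of \<open>x\<close> determines the action of the word.
\<close>

lemma orbit_labelling:
  assumes a: "a \<in> \<Omega>" and w: "w \<in> lists \<Omega>"
  shows "orbit_labelling (\<gamma> w x, \<gamma> (a # w) x) = a"
  unfolding orbit_labelling_def
proof (rule some_equality)
  show "a \<in> \<Omega> \<and> (\<exists>u\<in>lists \<Omega>. (\<gamma> w x, \<gamma> (a # w) x) = (\<gamma> u x, \<gamma> (a # u) x))" using a w by blast
  fix b assume "b \<in> \<Omega> \<and> (\<exists>u\<in>lists \<Omega>. (\<gamma> w x, \<gamma> (a # w) x) = (\<gamma> u x, \<gamma> (b # u) x))"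
  then obtain u where b: "b \<in> \<Omega>" and u: "u \<in> lists \<Omega>" "\<gamma> w x = \<gamma> u x" "\<gamma> (a # w) x = \<gamma> (b # u) x"
    by blast
  have "\<gamma> u = \<gamma> w" using \<gamma>_free[OF w u(1,2)] by simp
  then have "\<gamma> (b # u) x = \<gamma> (b # w) x" by simp
  then have "\<gamma> (a # w) x = \<gamma> (b # w) x" using u(3) by (simp only:)
  then show "b = a" using Cons_inj[OF w a b] by blast
qed

lemma edge_word:
  assumes "(u, v) \<in> E"
  obtains a w where "a \<in> \<Omega>" "w \<in> lists \<Omega>" "u = \<gamma> w x" "v = \<gamma> (a # w) x"
proof -
  obtain w where w: "w \<in> lists \<Omega>" "\<gamma> w x = u" using reduced_word_exists[OF edge_verts(1)[OF assms]] by blast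
  have "v \<in> (\<lambda>a. \<gamma> (a # w) x) ` \<Omega>"
    using bij_betw_imp_surj_on[OF nbrs[OF w(1)]] assms w(2) by simp
  then show thesis using that w by blast
qed

lemma labelling_orbit_labelling: "labelling \<Omega> T orbit_labelling"
  unfolding labelling_def
proof (intro conjI ballI)
  fix y assume "y \<in> V"
  then obtain w where w: "w \<in> lists \<Omega>" "\<gamma> w x = y" using reduced_word_exists by blast
  show "bij_betw orbit_labelling (out_arcs (with_proj T) y) \<Omega>"
  proof (rule bij_betw_byWitness[where f' = "\<lambda>a. (y, \<gamma> (a # w) x)"])
    show "\<forall>e\<in>out_arcs (with_proj T) y. (y, \<gamma> (orbit_labelling e # w) x) = e"
    proof
      fix e assume "e \<in> out_arcs (with_proj T) y"
      then obtain z where e: "e = (y, z)" "(y, z) \<in> E" by (cases e) (auto simp: out_arcs_def)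
      have "z \<in> (\<lambda>a. \<gamma> (a # w) x) ` \<Omega>"
        using bij_betw_imp_surj_on[OF nbrs[OF w(1)]] e(2) w(2) by simp
      then obtain a where "z = \<gamma> (a # w) x" "a \<in> \<Omega>" by (rule imageE)
      then show "(y, \<gamma> (orbit_labelling e # w) x) = e"
        using orbit_labelling[OF _ w(1)] w(2) e(1) by metis
    qed
    show "\<forall>a\<in>\<Omega>. orbit_labelling (y, \<gamma> (a # w) x) = a" using orbit_labelling[OF _ w(1)] w(2) by metis
    show "orbit_labelling ` out_arcs (with_proj T) y \<subseteq> \<Omega>"
    proof
      fix a assume "a \<in> orbit_labelling ` out_arcs (with_proj T) y"
      then obtain e where "a = orbit_labelling e" "e \<in> out_arcs (with_proj T) y" by (rule imageE)
      then obtain u v where "a = orbit_labelling (u, v)" "(u, v) \<in> E" by (cases e) (auto simp: out_arcs_def)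
      then show "a \<in> \<Omega>" using edge_word orbit_labelling by metis
    qed
    show "(\<lambda>a. (y, \<gamma> (a # w) x)) ` \<Omega> \<subseteq> out_arcs (with_proj T) y"
    proof
      fix e assume "e \<in> (\<lambda>a. (y, \<gamma> (a # w) x)) ` \<Omega>"
      then obtain a where "e = (y, \<gamma> (a # w) x)" "a \<in> \<Omega>" by (rule imageE)
      then show "e \<in> out_arcs (with_proj T) y"
        using Cons_edge[of a w] w by (simp add: out_arcs_def del: word_action.simps)
    qed
  qed
next
  fix e assume "e \<in> E"
  then obtain u v where e: "e = (u, v)" "(u, v) \<in> E" by (cases e) auto
  obtain a w where aw: "a \<in> \<Omega>" "w \<in> lists \<Omega>" "u = \<gamma> w x" "v = \<gamma> (a # w) x" using edge_word[OF e(2)] .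
  \<comment> \<open>The inverse edge continues the walk by the same involution.\<close>
  have "orbit_labelling (v, \<gamma> (a # a # w) x) = a"
    unfolding aw(4) by (rule orbit_labelling) (use aw in auto)
  then have "orbit_labelling (v, u) = a" using \<gamma>_cancel[OF aw(1,2)] aw(3) by simp
  then show "orbit_labelling e = orbit_labelling (prod.swap e)"
    using orbit_labelling[OF aw(1,2)] aw(3,4) e(1) by simp
qed

lemma \<gamma>_preserves_orbit_labelling:
  assumes w: "w \<in> lists \<Omega>" and e: "(u, v) \<in> E"
  shows "orbit_labelling (\<gamma> w u, \<gamma> w v) = orbit_labelling (u, v)"
proof -
  obtain a w' where aw: "a \<in> \<Omega>" "w' \<in> lists \<Omega>" "u = \<gamma> w' x" "v = \<gamma> (a # w') x"
    using edge_word[OF e] .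
  have "\<gamma> w u = \<gamma> (w' @ w) x" "\<gamma> w v = \<gamma> (a # (w' @ w)) x"
    using \<gamma>_append[OF aw(2) base] \<gamma>_append[of "a # w'" x w] aw base by auto
  then show ?thesis
    using orbit_labelling[OF aw(1,2)] orbit_labelling[OF aw(1), of "w' @ w"] aw(2-4) w by simp
qed

lemma label_preserving_transitive:
  assumes "y \<in> V" "z \<in> V"
  shows "\<exists>g\<in>H. g y = z \<and> (\<forall>u v. (u, v) \<in> E \<longrightarrow> orbit_labelling (g u, g v) = orbit_labelling (u, v))"
proof -
  obtain w where w: "w \<in> lists \<Omega>" "\<gamma> w x = y" using reduced_word_exists[OF assms(1)] by blast
  obtain w' where w': "w' \<in> lists \<Omega>" "\<gamma> w' x = z" using reduced_word_exists[OF assms(2)] by blast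
  obtain i where i: "i \<in> H" "\<And>u. u \<in> V \<Longrightarrow> i (\<gamma> w u) = u" "\<And>u. u \<in> V \<Longrightarrow> \<gamma> w (i u) = u"
    using H_inverse[OF \<gamma>_H[OF w(1)]] by metis
  define g where "g = compose V (\<gamma> w') i"
  have gH: "g \<in> H" unfolding g_def by (intro H_compose \<gamma>_H w' i)
  have "g y = z" using i(2)[OF base] w(2) w'(2) assms(1) by (simp add: g_def compose_eq)
  moreover have "orbit_labelling (g u, g v) = orbit_labelling (u, v)" if e: "(u, v) \<in> E" for u v
  proof -
    have V: "u \<in> V" "v \<in> V" using e edge_verts by auto
    have ie: "(i u, i v) \<in> E" using aut_edge[OF H_aut[OF i(1)] e] .
    have "orbit_labelling (g u, g v) = orbit_labelling (i u, i v)"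
      using \<gamma>_preserves_orbit_labelling[OF w'(1) ie] V by (simp add: g_def compose_eq)
    also have "\<dots> = orbit_labelling (\<gamma> w (i u), \<gamma> w (i v))"
      by (rule \<gamma>_preserves_orbit_labelling[OF w(1) ie, symmetric])
    finally show ?thesis using i(3) V by simp
  qed
  ultimately show ?thesis using gH by blast
qed

end

context tree_subgroup
begin

text \<open>
The involution at \<open>x\<close> assigned to a label \<open>a\<close> is the one that moves \<open>x\<close> to the neighbour \<open>b a\<close>, for a
bijection \<open>b\<close> between the labels and the neighbours of \<open>x\<close>.
\<close>

lemma invariant_labelling_exists:
  fixes \<Omega> :: "'w set"
  assumes fin: "finite \<Omega>" and card: "card \<Omega> = d" and d: "0 < d"
    and lt: "locally_transitive T H" and inv: "\<exists>g\<in>H. involutive_inversion T g"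
  shows "\<exists>l. labelling \<Omega> T l \<and> (\<forall>y\<in>V. \<forall>z\<in>V. \<exists>g\<in>H. g y = z \<and>
    (\<forall>u v. (u, v) \<in> E \<longrightarrow> l (g u, g v) = l (u, v)))"
proof -
  obtain s where s: "s \<in> H" "involutive_inversion T s" using inv by blast
  obtain x y where xy: "(x, y) \<in> E" "s x = y" "s y = x"
    using s(2) unfolding involutive_inversion_def by force
  have "s [^]\<^bsub>aut_group T\<^esub> (2::nat) = \<one>\<^bsub>aut_group T\<^esub>"
    using group.pow_ord_eq_1[OF group_aut_group, of s T] s(2) H_aut[OF s(1)]
    by (simp add: involutive_inversion_def aut_carrier)
  then have "compose V s s = (\<lambda>x\<in>V. x)"
    using monoid.nat_pow_Suc[OF group.is_monoid[OF group_aut_group], of T s]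
      monoid.l_one[OF group.is_monoid[OF group_aut_group], of s T] H_aut[OF s(1)]
    by (simp add: numeral_2_eq_2 aut_mult aut_one aut_carrier)
  then have s2: "s (s u) = u" if "u \<in> V" for u using that by (metis compose_eq restrict_apply')
  let ?N = "{y. (x, y) \<in> E}"
  have x: "x \<in> V" using xy edge_verts by blast
  have ex: "\<forall>z\<in>?N. \<exists>f. f \<in> H \<and> f x = z \<and> (\<forall>u\<in>V. f (f u) = u)"
    using involutive_inversion_at_vertex[OF lt s(1) xy(1,2) s2] by blast
  then obtain f where f: "\<And>z. z \<in> ?N \<Longrightarrow> f z \<in> H" "\<And>z. z \<in> ?N \<Longrightarrow> f z x = z"
    "\<And>z u. z \<in> ?N \<Longrightarrow> u \<in> V \<Longrightarrow> f z (f z u) = u"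
    by metis
  have "out_degree (with_proj T) x = d" using regular_tree x by (simp add: regular_tree_def)
  moreover have "out_arcs (with_proj T) x = Pair x ` ?N" by (auto simp: out_arcs_def)
  ultimately have cN: "card ?N = d" by (simp add: out_degree_def card_image inj_on_def)
  then have "finite ?N" using d by (intro card_ge_0_finite) simp
  then obtain b where b: "bij_betw b \<Omega> ?N" using finite_same_card_bij[OF fin] cN card by auto
  have bN: "b a \<in> ?N" if "a \<in> \<Omega>" for a using bij_betwE[OF b] that by blast
  interpret G: involutive_generators d T H \<Omega> x "\<lambda>a. f (b a)"
  proof unfold_locales
    show "bij_betw (\<lambda>a. f (b a) x) \<Omega> ?N"
      by (rule bij_betw_cong[THEN iffD1, OF _ b]) (simp only: f(2)[OF bN])
  qed (use x in simp, rule f(1)[OF bN], assumption, rule f(3)[OF bN], assumption+)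
  show ?thesis using G.labelling_orbit_labelling G.label_preserving_transitive by blast
qed

text \<open>
\<open>F\<close> consists of all local actions of elements of \<open>H\<close>, at all vertices. To multiply \<open>act h y\<close> and
\<open>act h' y'\<close>, insert between \<open>h\<close> and \<open>h'\<close> a label-preserving element of \<open>H\<close> that moves \<open>h' y'\<close> to \<open>y\<close>; its
local action is trivial, so the cocycle identity shows that the product is again in \<open>F\<close>.
\<close>

lemma universal_group_if_k_closed:
  fixes \<Omega> :: "'w set" and B :: "'b pair_pre_digraph"
  assumes card: "2 \<le> card \<Omega>" and model: "labelled_ball_model \<Omega> T k B lB" and l: "labelling \<Omega> T l"
    and trans: "\<forall>y\<in>V. \<forall>z\<in>V. \<exists>g\<in>H. g y = z \<and> (\<forall>u v. (u, v) \<in> E \<longrightarrow> l (g u, g v) = l (u, v))"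
    and closed: "k_closed k H"
  shows "\<exists>F. subgroup F (aut_group B) \<and> H = universal_group T k B lB l F"
proof -
  interpret labelled_tree d T \<Omega> k B lB l by unfold_locales (fact card model l)+
  define F where "F = {act h y | h y. h \<in> H \<and> y \<in> V}"
  have moves: "\<exists>g\<in>H. g y = z \<and> act g y = (\<lambda>b\<in>pverts B. b)" if yz: "y \<in> V" "z \<in> V" for y z
  proof -
    obtain g where "g \<in> H" "g y = z" "\<forall>u v. (u, v) \<in> E \<longrightarrow> l (g u, g v) = l (u, v)"
      using trans yz by blast
    then show ?thesis using act_label_preserving[OF H_aut _ yz(1), of g] by blast
  qed
  have FA: "f \<in> graph_auts B" if "f \<in> F" for f using that act_aut H_aut unfolding F_def by blast
  have mult: "f \<otimes>\<^bsub>aut_group B\<^esub> f' = compose (pverts B) f f'" if "f \<in> F" "f' \<in> F" for f f'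
    using FA[OF that(1)] FA[OF that(2)] by (simp add: aut_group_def BijGroup_def graph_auts_def)
  have F_compose: "compose (pverts B) f f' \<in> F" if ff': "f \<in> F" "f' \<in> F" for f f'
  proof -
    obtain h y where h: "f = act h y" "h \<in> H" "y \<in> V" using ff'(1) unfolding F_def by blast
    obtain h' y' where h': "f' = act h' y'" "h' \<in> H" "y' \<in> V" using ff'(2) unfolding F_def by blast
    have hy': "h' y' \<in> V" using autD(4)[OF H_aut[OF h'(2)] h'(3)] .
    obtain g where g: "g \<in> H" "g (h' y') = y" "act g (h' y') = (\<lambda>b\<in>pverts B. b)"
      using moves[OF hy' h(3)] by blast
    have gh': "compose V g h' \<in> H" by (rule H_compose[OF g(1) h'(2)])
    have "f' \<in> extensional (pverts B)" "f' \<in> pverts B \<rightarrow> pverts B"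
      using FA[OF ff'(2)] unfolding graph_auts_def Bij_def by (auto dest: bij_betwE)
    then have "act (compose V g h') y' = f'"
      using act_compose[OF H_aut[OF g(1)] H_aut[OF h'(2)] h'(3)] g(3) h'(1) by simp
    moreover have "compose V g h' y' = y" using g(2) h'(3) by (simp add: compose_eq)
    ultimately have "act (compose V h (compose V g h')) y' = compose (pverts B) f f'"
      using act_compose[OF H_aut[OF h(2)] H_aut[OF gh'] h'(3)] h(1) by simp
    then show ?thesis
      using H_compose[OF h(2) gh'] h'(3) unfolding F_def
      by (intro CollectI exI[of _ "compose V h (compose V g h')"] exI[of _ y']) simp
  qed
  have subF: "subgroup F (aut_group B)"
  proof (rule group.subgroupI[OF group_aut_group])
    show "F \<subseteq> carrier (aut_group B)" using FA by (auto simp: aut_group_def)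
    show "F \<noteq> {}" using H_one verts_nonempty unfolding F_def by blast
  next
    fix f assume fF: "f \<in> F"
    then obtain h y where h: "f = act h y" "h \<in> H" "y \<in> V" unfolding F_def by blast
    obtain i where i: "i \<in> H" "\<And>u. u \<in> V \<Longrightarrow> i (h u) = u" using H_inverse[OF h(2)] by metis
    have iF: "act i (h y) \<in> F" using i(1) autD(4)[OF H_aut[OF h(2)] h(3)] unfolding F_def by blast
    have "act i (h y) \<otimes>\<^bsub>aut_group B\<^esub> f = \<one>\<^bsub>aut_group B\<^esub>"
      using act_inverse[OF H_aut[OF h(2)] H_aut[OF i(1)] i(2) h(3)] mult[OF iF fF] h(1)
      by (simp add: aut_group_def BijGroup_def)
    then have "inv\<^bsub>aut_group B\<^esub> f = act i (h y)"
      using group.inv_equality[OF group_aut_group] FA[OF fF] FA[OF iF] by (simp add: aut_group_def)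
    then show "inv\<^bsub>aut_group B\<^esub> f \<in> F" using iF by simp
  next
    fix f f' assume "f \<in> F" "f' \<in> F"
    then show "f \<otimes>\<^bsub>aut_group B\<^esub> f' \<in> F" using mult F_compose by simp
  qed
  have "H = universal_group T k B lB l F"
  proof
    show "H \<subseteq> universal_group T k B lB l F"
      using H_aut unfolding universal_group_def F_def by blast
    show "universal_group T k B lB l F \<subseteq> H"
    proof
      fix g assume "g \<in> universal_group T k B lB l F"
      then have g: "g \<in> Aut" "\<And>y. y \<in> V \<Longrightarrow> act g y \<in> F" by (auto simp: universal_group_def)
      have "\<exists>h\<in>H. \<forall>z\<in>V. dist y z \<le> k \<longrightarrow> g z = h z" if y: "y \<in> V" for y
      proof -
        obtain h z where h: "act g y = act h z" "h \<in> H" "z \<in> V" using g(2)[OF y] unfolding F_def by blast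
        have hz: "h z \<in> V" using autD(4)[OF H_aut[OF h(2)] h(3)] .
        obtain a where a: "a \<in> H" "a y = z" "act a y = (\<lambda>b\<in>pverts B. b)" using moves[OF y h(3)] by blast
        obtain b where b: "b \<in> H" "b (h z) = g y" "act b (h z) = (\<lambda>b\<in>pverts B. b)"
          using moves[OF hz autD(4)[OF g(1) y]] by blast
        have ha: "compose V h a \<in> H" by (rule H_compose[OF h(2) a(1)])
        \<comment> \<open>Label-preserving factors on both sides move \<open>y\<close> to \<open>z\<close> and \<open>h z\<close> to \<open>g y\<close> without changing the local action.\<close>
        define f where "f = compose V b (compose V h a)"
        have fH: "f \<in> H" unfolding f_def by (rule H_compose[OF b(1) ha])
        have "act h z \<in> extensional (pverts B)" "act h z \<in> pverts B \<rightarrow> pverts B"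
          using act_aut[OF H_aut[OF h(2)] h(3)] unfolding graph_auts_def Bij_def by (auto dest: bij_betwE)
        moreover have "compose V h a y = h z" using a(2) y by (simp add: compose_eq)
        ultimately have "act f y = act h z"
          using act_compose[OF H_aut[OF b(1)] H_aut[OF ha] y]
            act_compose[OF H_aut[OF h(2)] H_aut[OF a(1)] y] a b unfolding f_def by simp
        moreover have "f y = g y" using a(2) b(2) y by (simp add: f_def compose_eq)
        ultimately have "g z' = f z'" if "z' \<in> V" "dist y z' \<le> k" for z'
          using act_determines[OF g(1) H_aut[OF fH] y, of z'] h(1) that by simp
        with fH show ?thesis by blast
      qed
      then show "g \<in> H" using closed g(1) unfolding k_closed_def locally_in_def by blast
    qed
  qed
  with subF show ?thesis by blast
qed

end

section \<open>Universal groups and the independence property\<close>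

theorem corollary4p32:
  fixes d k :: nat
    and \<Omega> :: "'w set"
    and T :: "'v pair_pre_digraph"
    and B :: "'b pair_pre_digraph"
    and lB :: "'b \<times> 'b \<Rightarrow> 'w"
    and H :: "('v \<Rightarrow> 'v) set"
  assumes "3 \<le> d" and "1 \<le> k"
    and "finite \<Omega>" and "card \<Omega> = d"
    and "regular_tree d T"
    and "labelled_ball_model \<Omega> T k B lB"
    and "subgroup H (aut_group T)"
    and "closedin (permutation_topology T) H"
    and "locally_transitive T H"
    and "\<exists>g\<in>H. involutive_inversion T g"
  shows "(\<exists>l F. labelling \<Omega> T l \<and> subgroup F (aut_group B) \<and> H = universal_group T k B lB l F)
           \<longleftrightarrow> property_P k T H"
proof -
  interpret tree_subgroup d T H
    by (intro tree_subgroup.intro regular_tree_graph.intro tree_subgroup_axioms.intro) (fact assms)+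
  have card: "2 \<le> card \<Omega>" using assms(1,4) by simp
  show ?thesis
  proof
    assume "\<exists>l F. labelling \<Omega> T l \<and> subgroup F (aut_group B) \<and> H = universal_group T k B lB l F"
    then obtain l F where l: "labelling \<Omega> T l" "H = universal_group T k B lB l F" by blast
    interpret labelled_tree d T \<Omega> k B lB l by unfold_locales (fact card assms(6) l(1))+
    have "k_closed k H" using universal_group_k_closed[of F] l(2) by simp
    then show "property_P k T H" by (rule k_closed_imp_property_P[OF assms(2)])
  next
    assume "property_P k T H"
    then have closed: "k_closed k H" using property_P_imp_k_closed assms(2,8) by blast
    obtain l where l: "labelling \<Omega> T l" "\<forall>y\<in>V. \<forall>z\<in>V. \<exists>g\<in>H. g y = z \<and>
        (\<forall>u v. (u, v) \<in> E \<longrightarrow> l (g u, g v) = l (u, v))"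
      using invariant_labelling_exists[OF assms(3,4) _ assms(9,10)] assms(1) by auto
    then show "\<exists>l F. labelling \<Omega> T l \<and> subgroup F (aut_group B) \<and> H = universal_group T k B lB l F"
      using universal_group_if_k_closed[OF card assms(6) l(1,2) closed] by blast
  qed
qed

end
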